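(* Let $r,p\in\mathcal{P}(\mathbb{R}^n)$, let $q$ be the conjugate exponent of $p$, and let $m>n$. Then: (1) There is a constant $C>0$ such that $\|k*f\|_{L^{r(\cdot)}(\mathbb{R}^n)}\le C\,\|k\|_{L^\infty(\mathbb{R}^n)\cap L^{r^-}(\mathbb{R}^n)}\,\|f\|_{L^{p(\cdot)}(\mathbb{R}^n)\cap L^1(\mathbb{R}^n)}$ for all $k\in L^\infty(\mathbb{R}^n)\cap L^{r^-}(\mathbb{R}^n)$ and $f\in L^{p(\cdot)}(\mathbb{R}^n)\cap L^1(\mathbb{R}^n)$. (2) There is a constant $C>0$ such that for every $\tau>0$ and every $f\in L^{p(\cdot)}(\mathbb{R}^n)\cap L^1(\mathbb{R}^n)$, $$\|\eta_{\tau,m}*f\|_{L^{r(\cdot)}(\mathbb{R}^n)}\le C\,\tau^{-n\vartheta(\tau)}\,\|f\|_{L^{p(\cdot)}(\mathbb{R}^n)\cap L^1(\mathbb{R}^n)},$$ where $\zeta(\tau)=\frac1{p^-}$ if $\tau\in(0,1]$ and $\zeta(\tau)=\frac1{p^+}$ if $\tau>1$; if $r^-=\infty$ then $\vartheta(\tau)=\zeta(\tau)$; and if $r^-<\infty$ then $$\vartheta(\tau)=\begin{cases}\frac{r^-}{r^+}\left(1-\frac1{r^-}\right)+\zeta(\tau)\left(1-\frac{r^-}{r^+}\right), & \text{if } \left(0<\tau\le1 \text{ and } 1-\frac1{r^-}\le\zeta(\tau)\right)\text{ or }\left(\tau>1\text{ and }1-\frac1{r^-}>\zeta(\tau)\right),\\[4pt]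 1-\frac1{r^-}, & \text{if } \left(0<\tau\le1 \text{ and } 1-\frac1{r^-}>\zeta(\tau)\right)\text{ or }\left(\tau>1\text{ and }1-\frac1{r^-}\le\zeta(\tau)\right).\end{cases}$$ (3) For every $1\le\nu\le r^-$ there is a constant $C>0$ such that for every $\tau>0$ and every $f\in L^{p(\cdot)}(\mathbb{R}^n)\cap L^\nu(\mathbb{R}^n)$, $$\|\eta_{\tau,m}*f\|_{L^{r(\cdot)}(\mathbb{R}^n)}\le C\,\tau^{-n\omega(\tau)}\,\|f\|_{L^{p(\cdot)}(\mathbb{R}^n)\cap L^\nu(\mathbb{R}^n)},\qquad \omega(\tau)=\begin{cases}\frac1{p^-}\left(1-\frac{\nu}{r^+}\right), & 0<\tau\le1,\\ \frac1{p^+}\left(1-\frac{\nu}{r^-}\right), & \tau>1,\end{cases}$$ with the convention $\frac{\nu}{\infty}=0$ for $\nu\in[1,+\infty]$. (4) If $1\in L^{s(\cdot)}(\mathbb{R}^n)$, where $s\in\mathcal{P}(\mathbb{R}^n)$ is defined by $\frac1{s(x)}:=\max\left\{\frac1{p^-}-\frac1{p(x)},0\right\}$ for all $x\in\mathbb{R}^n$, then there is a constant $C>0$ such that $$\|k*f\|_{L^{r(\cdot)}(\mathbb{R}^n)}\le C\,\|k\|_{L^{q^+}(\mathbb{R}^n)\cap L^{r^-}(\mathbb{R}^n)}\,\|f\|_{L^{p(\cdot)}(\mathbb{R}^n)\cap L^1(\mathbb{R}^n)}$$ for all $k\in L^{q^+}(\mathbb{R}^n)\cap L^{r^-}(\mathbb{R}^n)$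 and $f\in L^{p(\cdot)}(\mathbb{R}^n)\cap L^1(\mathbb{R}^n)$.
   Context: $\mathcal{P}(\mathbb{R}^n)$ is the set of measurable functions $p:\mathbb{R}^n\to[1,\infty]$; $p^-$ and $p^+$ are the essential infimum and supremum of $p$; the conjugate exponent $q$ of $p$ satisfies $\frac1{p(x)}+\frac1{q(x)}=1$, with $\frac{a}{\infty}:=0$. The modular is $\varrho_{p(\cdot)}(f)=\int_{\mathbb{R}^n}\omega_{p(x)}(|f(x)|)\,dx$, with $\omega_p(t)=t^p$ if $p<\infty$, and $\omega_\infty(t)=0$ for $t\le1$, $\omega_\infty(t)=\infty$ for $t>1$. $L^{p(\cdot)}(\mathbb{R}^n)$ is the space of measurable $f$ with $\varrho_{p(\cdot)}(\lambda f)<\infty$ for some $\lambda>0$, normed by $\|f\|_{L^{p(\cdot)}}=\inf\{\lambda>0:\varrho_{p(\cdot)}(f/\lambda)\le1\}$. An intersection $X\cap Y$ of normed spaces carries the norm $\max\{\|f\|_X,\|f\|_Y\}$. $\eta_{t,m}(x):=t^{-n}(1+t^{-1}|x|)^{-m}$ for $x\in\mathbb{R}^n$, $t>0$, $m>0$. *)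

theory Defs
  imports "HOL-Analysis.Analysis" "HOL-Probability.Essential_Supremum"
begin

text \<open>
  Exponents take values in \<^typ>\<open>ennreal\<close>, where \<open>1 / \<infinity> = 0\<close>, \<open>1 / 0 = \<infinity>\<close> and \<open>\<infinity> / \<infinity> = 0\<close>; so
  the convention \<open>a / \<infinity> = 0\<close>, including \<open>a = \<infinity>\<close>, is the library's own. Measurability and
  integration are with respect to Lebesgue measure. The dimension is \<open>CARD('n)\<close>.
  Norms are \<^typ>\<open>ennreal\<close>-valued and are finite on the corresponding space.
\<close>

definition var_exponents :: "(real ^ 'n \<Rightarrow> ennreal) set" where
  "var_exponents = {p \<in> borel_measurable lebesgue. \<forall>x. 1 \<le> p x}"

definition exp_minus :: "(real ^ 'n \<Rightarrow> ennreal) \<Rightarrow> ennreal" where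
  "exp_minus p = Sup {c. AE x in lebesgue. c \<le> p x}"

definition exp_plus :: "(real ^ 'n \<Rightarrow> ennreal) \<Rightarrow> ennreal" where
  "exp_plus p = esssup lebesgue p"

definition conjugate_exponent :: "(real ^ 'n \<Rightarrow> ennreal) \<Rightarrow> (real ^ 'n \<Rightarrow> ennreal) \<Rightarrow> bool" where
  "conjugate_exponent p q \<longleftrightarrow> (\<forall>x. 1 / p x + 1 / q x = 1)"

definition omega_mod :: "ennreal \<Rightarrow> real \<Rightarrow> ennreal" where
  "omega_mod p t =
     (if p = \<infinity> then (if t \<le> 1 then 0 else \<infinity>) else ennreal (t powr enn2real p))"

definition modular :: "(real ^ 'n \<Rightarrow> ennreal) \<Rightarrow> (real ^ 'n \<Rightarrow> complex) \<Rightarrow> ennreal" where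
  "modular p f = (\<integral>\<^sup>+ x. omega_mod (p x) (norm (f x)) \<partial>lebesgue)"

definition Lvar :: "(real ^ 'n \<Rightarrow> ennreal) \<Rightarrow> (real ^ 'n \<Rightarrow> complex) set" where
  "Lvar p = {f \<in> borel_measurable lebesgue. \<exists>l>0. modular p (\<lambda>x. complex_of_real l * f x) < \<infinity>}"

definition Lvar_norm :: "(real ^ 'n \<Rightarrow> ennreal) \<Rightarrow> (real ^ 'n \<Rightarrow> complex) \<Rightarrow> ennreal" where
  "Lvar_norm p f = Inf {ennreal l | l. 0 < l \<and> modular p (\<lambda>x. f x / complex_of_real l) \<le> 1}"

text \<open>The classical Lebesgue spaces with a constant exponent \<open>s \<in> [1, \<infinity>]\<close>.\<close>

definition Lp_norm :: "ennreal \<Rightarrow> (real ^ 'n \<Rightarrow> complex) \<Rightarrow> ennreal" where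
  "Lp_norm s f =
     (if s = \<infinity> then esssup lebesgue (\<lambda>x. ennreal (norm (f x)))
      else let I = (\<integral>\<^sup>+ x. ennreal (norm (f x) powr enn2real s) \<partial>lebesgue)
           in if I = \<infinity> then \<infinity> else ennreal (enn2real I powr (1 / enn2real s)))"

definition Lp :: "ennreal \<Rightarrow> (real ^ 'n \<Rightarrow> complex) set" where
  "Lp s = {f \<in> borel_measurable lebesgue. Lp_norm s f < \<infinity>}"

definition conv :: "(real ^ 'n \<Rightarrow> complex) \<Rightarrow> (real ^ 'n \<Rightarrow> complex) \<Rightarrow> real ^ 'n \<Rightarrow> complex" where
  "conv k f x = (LINT y|lebesgue. k (x - y) * f y)"

text \<open>The Bochner integral is \<open>0\<close> for non-integrable integrands, so that the convolution is
  genuinely defined (almost everywhere) has to be said separately.\<close>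

definition conv_defined :: "(real ^ 'n \<Rightarrow> complex) \<Rightarrow> (real ^ 'n \<Rightarrow> complex) \<Rightarrow> bool" where
  "conv_defined k f \<longleftrightarrow> (AE x in lebesgue. integrable lebesgue (\<lambda>y. k (x - y) * f y))"

definition eta :: "real \<Rightarrow> real \<Rightarrow> real ^ 'n \<Rightarrow> complex" where
  "eta t m x = complex_of_real (t powr (- real CARD('n)) * (1 + norm x / t) powr (- m))"

definition zeta_exp :: "(real ^ 'n \<Rightarrow> ennreal) \<Rightarrow> real \<Rightarrow> real" where
  "zeta_exp p \<tau> = (if \<tau> \<le> 1 then enn2real (1 / exp_minus p) else enn2real (1 / exp_plus p))"

definition theta_exp :: "(real ^ 'n \<Rightarrow> ennreal) \<Rightarrow> (real ^ 'n \<Rightarrow> ennreal) \<Rightarrow> real \<Rightarrow> real" where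
  "theta_exp p r \<tau> =
     (let \<zeta> = zeta_exp p \<tau>;
          a = 1 - enn2real (1 / exp_minus r);
          b = enn2real (exp_minus r / exp_plus r)
      in if exp_minus r = \<infinity> then \<zeta>
         else if (0 < \<tau> \<and> \<tau> \<le> 1 \<and> a \<le> \<zeta>) \<or> (\<tau> > 1 \<and> a > \<zeta>) then b * a + \<zeta> * (1 - b)
         else a)"

definition omega_exp ::
  "(real ^ 'n \<Rightarrow> ennreal) \<Rightarrow> (real ^ 'n \<Rightarrow> ennreal) \<Rightarrow> ennreal \<Rightarrow> real \<Rightarrow> real" where
  "omega_exp p r \<nu> \<tau> =
     (if \<tau> \<le> 1 then enn2real (1 / exp_minus p) * (1 - enn2real (\<nu> / exp_plus r))
      else enn2real (1 / exp_plus p) * (1 - enn2real (\<nu> / exp_minus r)))"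

text \<open>Subtraction on \<^typ>\<open>ennreal\<close> truncates at \<open>0\<close>, which the maximum with \<open>0\<close> absorbs.\<close>

definition gap_exponent :: "(real ^ 'n \<Rightarrow> ennreal) \<Rightarrow> real ^ 'n \<Rightarrow> ennreal" where
  "gap_exponent p x = 1 / max (1 / exp_minus p - 1 / p x) 0"

end

theory Submission
  imports Defs
begin

text \<open>
  Normalise \<open>f\<close> so that its modular is at most \<open>1\<close>, and cut it at height \<open>1\<close>. Where \<open>\<bar>f\<bar> > 1\<close> the modular
  dominates \<open>\<bar>f\<bar>\<close> to the power \<open>p\<^sup>-\<close>; elsewhere it dominates \<open>\<bar>f\<bar>\<close> to the power \<open>p\<^sup>+\<close>, and \<open>\<bar>f\<bar> \<le> 1\<close>. Hoelder's
  inequality with constant exponents then bounds the convolution uniformly by some \<open>A\<close>, and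
  Young's inequality bounds it by some \<open>B\<close> in \<open>L\<^sup>\<nu>\<close> with \<open>\<nu> \<le> r\<^sup>-\<close>. Writing
  \<open>(\<bar>g\<bar> / L)\<^bsup>r(x)\<^esup> = (\<bar>g\<bar> / A)\<^bsup>r(x)\<^esup> (A / L)\<^bsup>r(x)\<^esup> \<le> (\<bar>g\<bar> / A)\<^bsup>\<nu>\<^esup> (A / L)\<^bsup>r(x)\<^esup>\<close> shows that
  \<open>L = A\<^bsup>1-\<beta>\<^esup> B\<^bsup>\<beta>\<^esup>\<close> bounds the norm in \<open>L\<^bsup>r(\<cdot>)\<^esup>\<close>, where \<open>\<beta> = \<nu> / r\<^sup>-\<close> if \<open>A \<le> B\<close> and \<open>\<beta> = \<nu> / r\<^sup>+\<close> if \<open>B \<le> A\<close>.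
\<close>

subsection \<open>Exponents, reflections and convolutions\<close>

text \<open>The supremum ranges over uncountably many bounds, but it is reached along a sequence, so
  only countably many null sets are discarded.\<close>

lemma AE_exp_minus_le:
  fixes p :: "real ^ 'n \<Rightarrow> ennreal"
  shows "AE x in lebesgue. exp_minus p \<le> p x"
proof -
  let ?A = "{c. AE x in lebesgue. c \<le> p x}"
  have "0 \<in> ?A"
    by simp
  then obtain c :: "nat \<Rightarrow> ennreal" where c: "range c \<subseteq> ?A" "Sup ?A = (SUP i. c i)"
    using ennreal_Sup_countable_SUP[of ?A] by blast
  have "AE x in lebesgue. \<forall>i. c i \<le> p x"
    using c(1) by (subst AE_all_countable) auto
  then show ?thesis
    by eventually_elim (simp add: exp_minus_def c(2) SUP_le_iff)
qed

lemma AE_le_exp_plus: "AE x in lebesgue. p x \<le> exp_plus p"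
  unfolding exp_plus_def by (rule esssup_AE)

lemma exp_minus_ge:
  assumes "AE x in lebesgue. c \<le> p x"
  shows "c \<le> exp_minus p"
  unfolding exp_minus_def by (rule Sup_upper) (use assms in simp)

text \<open>Lebesgue measure is not zero. This turns almost everywhere comparisons into comparisons
  of the numbers \<open>exp_minus\<close> and \<open>exp_plus\<close>.\<close>

lemma AE_lebesgue_const:
  assumes "AE x in (lebesgue :: 'a::euclidean_space measure). P"
  shows P
proof -
  have "ae_filter (lebesgue :: 'a measure) \<noteq> bot"
    by (simp add: ae_filter_eq_bot_iff)
  then show ?thesis
    using assms by simp
qed

lemma exp_minus_le_exp_plus:
  fixes p :: "real ^ 'n \<Rightarrow> ennreal"
  shows "exp_minus p \<le> exp_plus p"
proof -
  have "AE x in (lebesgue :: (real ^ 'n) measure). exp_minus p \<le> exp_plus p"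
    using AE_exp_minus_le[of p] AE_le_exp_plus[of p] by eventually_elim auto
  then show ?thesis
    by (rule AE_lebesgue_const)
qed

text \<open>The affine substitution rule with factor -1 in every coordinate; its Jacobian has
  absolute value 1.\<close>

lemma lebesgue_reflect:
  fixes x :: "'a::euclidean_space"
  shows measurable_lebesgue_reflect: "(\<lambda>y. x - y) \<in> lebesgue \<rightarrow>\<^sub>M lebesgue"
    and distr_lebesgue_reflect: "distr lebesgue lebesgue (\<lambda>y. x - y) = lebesgue"
proof -
  have eq: "(\<lambda>y. x + (\<Sum>j\<in>Basis. (- 1 * (y \<bullet> j)) *\<^sub>R j)) = (\<lambda>y. x - y)"
    by (simp add: sum_negf euclidean_representation)
  show "(\<lambda>y. x - y) \<in> lebesgue \<rightarrow>\<^sub>M lebesgue"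
    using lebesgue_affine_measurable[of "\<lambda>_. - 1" x] unfolding eq by simp
  show "distr lebesgue lebesgue (\<lambda>y. x - y) = lebesgue"
    using lebesgue_affine_euclidean[of "\<lambda>_. - 1" x] unfolding eq by (simp add: density_1)
qed

lemma borel_measurable_reflect:
  fixes x :: "'a::euclidean_space"
  assumes "f \<in> borel_measurable lebesgue"
  shows "(\<lambda>y. f (x - y)) \<in> borel_measurable lebesgue"
  using measurable_compose[OF measurable_lebesgue_reflect assms] .

lemma AE_reflect:
  fixes x :: "'a::euclidean_space"
  assumes "AE y in lebesgue. P y"
  shows "AE y in lebesgue. P (x - y)"
  by (rule AE_distrD[OF measurable_lebesgue_reflect]) (subst distr_lebesgue_reflect, rule assms)

lemma nn_integral_reflect:
  fixes x :: "'a::euclidean_space"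
  assumes "f \<in> borel_measurable lebesgue"
  shows "(\<integral>\<^sup>+y. f (x - y) \<partial>lebesgue) = (\<integral>\<^sup>+y. f y \<partial>lebesgue)"
  using nn_integral_distr[OF measurable_lebesgue_reflect[of x], of f] assms
  by (simp add: distr_lebesgue_reflect)

text \<open>Borel representatives make \<open>(x, y) \<mapsto> k (x - y) * f y\<close> jointly
  measurable on the product space; real and imaginary parts are replaced separately.\<close>

lemma lebesgue_AE_eq_borel:
  fixes f :: "'a::euclidean_space \<Rightarrow> complex"
  assumes "f \<in> borel_measurable lebesgue"
  obtains g where "g \<in> borel_measurable borel" "AE x in lebesgue. f x = g x"
proof -
  obtain u where u: "u \<in> borel_measurable lborel" "AE x in lborel. Re (f x) = u x"
    using completion_ex_borel_measurable_real[of "\<lambda>x. Re (f x)" lborel] assms by auto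
  obtain v where v: "v \<in> borel_measurable lborel" "AE x in lborel. Im (f x) = v x"
    using completion_ex_borel_measurable_real[of "\<lambda>x. Im (f x)" lborel] assms by auto
  show thesis
  proof
    have [measurable]: "u \<in> borel_measurable borel" "v \<in> borel_measurable borel"
      using u(1) v(1) by auto
    show "(\<lambda>x. Complex (u x) (v x)) \<in> borel_measurable borel"
      unfolding Complex_eq by measurable
    have "AE x in lborel. f x = Complex (u x) (v x)"
      using u(2) v(2) by eventually_elim (simp add: complex_eq_iff)
    then show "AE x in lebesgue. f x = Complex (u x) (v x)"
      by (rule AE_completion)
  qed
qed

text \<open>Since reflection preserves null sets, passing to Borel representatives leaves
  \<open>conv k f x\<close> unchanged at every \<open>x\<close>. For them, the integral depends
  measurably on the parameter.\<close>

lemma borel_measurable_conv: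
  fixes k f :: "real ^ 'n \<Rightarrow> complex"
  assumes "k \<in> borel_measurable lebesgue" "f \<in> borel_measurable lebesgue"
  shows "conv k f \<in> borel_measurable lebesgue"
proof -
  obtain k' where k': "k' \<in> borel_measurable borel" "AE x in lebesgue. k x = k' x"
    using lebesgue_AE_eq_borel[OF assms(1)] .
  obtain f' where f': "f' \<in> borel_measurable borel" "AE x in lebesgue. f x = f' x"
    using lebesgue_AE_eq_borel[OF assms(2)] .
  note [measurable] = k'(1) f'(1)
  have "conv k f x = (LINT y|lborel. k' (x - y) * f' y)" for x
  proof -
    have "conv k f x = (LINT y|lebesgue. k' (x - y) * f' y)"
      unfolding conv_def
    proof (rule integral_cong_AE)
      show "AE y in lebesgue. k (x - y) * f y = k' (x - y) * f' y"
        using AE_reflect[OF k'(2), of x] f'(2) by eventually_elim simp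
      show "(\<lambda>y. k (x - y) * f y) \<in> borel_measurable lebesgue"
        using borel_measurable_reflect[OF assms(1)] assms(2) by measurable
      show "(\<lambda>y. k' (x - y) * f' y) \<in> borel_measurable lebesgue"
        by (rule measurable_completion) measurable
    qed
    also have "\<dots> = (LINT y|lborel. k' (x - y) * f' y)"
      by (rule integral_completion) measurable
    finally show ?thesis .
  qed
  then have "conv k f = (\<lambda>x. LINT y|lborel. k' (x - y) * f' y)"
    by auto
  moreover have "(\<lambda>x. LINT y|lborel. k' (x - y) * f' y) \<in> borel_measurable lborel"
    by (rule lborel.borel_measurable_lebesgue_integral) measurable
  ultimately show ?thesis
    using measurable_completion by metis
qed

text \<open>Substitution of \<open>x - y\<close> for \<open>y\<close>; where the integrand is not
  integrable, both Bochner integrals have the default value 0. It lets \<open>eta\<close> take the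
  place of the integrable factor in Young's inequality.\<close>

lemma conv_commute:
  fixes k f :: "real ^ 'n \<Rightarrow> complex"
  assumes [measurable]: "k \<in> borel_measurable lebesgue" "f \<in> borel_measurable lebesgue"
  shows "conv k f = conv f k"
proof
  fix x
  have [measurable]: "(\<lambda>y. k (x - y)) \<in> borel_measurable lebesgue"
    by (rule borel_measurable_reflect) fact
  have "conv k f x = (LINT y|distr lebesgue lebesgue (\<lambda>y. x - y). k (x - y) * f y)"
    by (simp add: conv_def distr_lebesgue_reflect)
  also have "\<dots> = (LINT y|lebesgue. k (x - (x - y)) * f (x - y))"
    by (rule integral_distr[OF measurable_lebesgue_reflect]) measurable
  finally show "conv k f x = conv f k x"
    by (simp add: conv_def mult.commute)
qed

text \<open>Tonelli's theorem for Borel representatives, followed by translation invariance in the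
  inner integral.\<close>

lemma nn_integral_conv:
  fixes u v :: "'a::euclidean_space \<Rightarrow> ennreal"
  assumes "u \<in> borel_measurable lebesgue" "v \<in> borel_measurable lebesgue"
  shows "(\<integral>\<^sup>+x. \<integral>\<^sup>+y. u (x - y) * v y \<partial>lebesgue \<partial>lebesgue)
    = (\<integral>\<^sup>+y. u y \<partial>lebesgue) * (\<integral>\<^sup>+y. v y \<partial>lebesgue)"
proof -
  obtain u' where u': "u' \<in> borel_measurable lborel" "AE x in lebesgue. u x = u' x"
    using completion_ex_borel_measurable[OF assms(1)] AE_completion by blast
  obtain v' where v': "v' \<in> borel_measurable lborel" "AE x in lebesgue. v x = v' x"
    using completion_ex_borel_measurable[OF assms(2)] AE_completion by blast
  have [measurable]: "u' \<in> borel_measurable borel" "v' \<in> borel_measurable borel"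
    using u'(1) v'(1) by auto
  have refl: "(\<integral>\<^sup>+x. u' (x - y) \<partial>lborel) = (\<integral>\<^sup>+x. u' x \<partial>lborel)" for y
  proof -
    have "(\<integral>\<^sup>+x. u' x \<partial>lborel) = (\<integral>\<^sup>+x. u' x \<partial>distr lborel borel ((+) (- y)))"
      by (simp add: lborel_distr_plus)
    also have "\<dots> = (\<integral>\<^sup>+x. u' (- y + x) \<partial>lborel)"
      by (rule nn_integral_distr) auto
    finally show ?thesis
      by simp
  qed
  have "(\<integral>\<^sup>+y. u (x - y) * v y \<partial>lebesgue) = (\<integral>\<^sup>+y. u' (x - y) * v' y \<partial>lborel)" for x
  proof -
    have "AE y in lebesgue. u (x - y) * v y = u' (x - y) * v' y"
      using AE_reflect[OF u'(2), of x] v'(2) by eventually_elim simp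
    then have "(\<integral>\<^sup>+y. u (x - y) * v y \<partial>lebesgue) = (\<integral>\<^sup>+y. u' (x - y) * v' y \<partial>lebesgue)"
      by (rule nn_integral_cong_AE)
    then show ?thesis
      by (simp add: nn_integral_completion)
  qed
  then have "(\<integral>\<^sup>+x. \<integral>\<^sup>+y. u (x - y) * v y \<partial>lebesgue \<partial>lebesgue)
      = (\<integral>\<^sup>+x. \<integral>\<^sup>+y. u' (x - y) * v' y \<partial>lborel \<partial>lborel)"
    by (simp add: nn_integral_completion)
  also have "\<dots> = (\<integral>\<^sup>+y. \<integral>\<^sup>+x. u' (x - y) * v' y \<partial>lborel \<partial>lborel)"
    by (rule lborel_pair.Fubini') measurable
  also have "\<dots> = (\<integral>\<^sup>+y. (\<integral>\<^sup>+x. u' x \<partial>lborel) * v' y \<partial>lborel)"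
    by (simp add: nn_integral_multc refl)
  also have "\<dots> = (\<integral>\<^sup>+x. u' x \<partial>lborel) * (\<integral>\<^sup>+y. v' y \<partial>lborel)"
    by (simp add: nn_integral_cmult)
  also have "(\<integral>\<^sup>+x. u' x \<partial>lborel) = (\<integral>\<^sup>+x. u x \<partial>lebesgue)"
    using nn_integral_cong_AE[OF u'(2)] by (simp add: nn_integral_completion)
  also have "(\<integral>\<^sup>+x. v' x \<partial>lborel) = (\<integral>\<^sup>+x. v x \<partial>lebesgue)"
    using nn_integral_cong_AE[OF v'(2)] by (simp add: nn_integral_completion)
  finally show ?thesis .
qed

section \<open>Hoelder's inequality for integrals, and norms with a constant exponent\<close>

lemma nn_integral_Hoelder:
  fixes a b :: "'a \<Rightarrow> real"
  assumes [measurable]: "a \<in> borel_measurable M" "b \<in> borel_measurable M"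
    and nonneg: "\<And>x. 0 \<le> a x" "\<And>x. 0 \<le> b x"
    and st: "1 < s" "1 < t" "1 / s + 1 / t = 1"
    and pos: "0 < A" "0 < B"
    and A: "(\<integral>\<^sup>+x. ennreal (a x powr s) \<partial>M) \<le> ennreal (A powr s)"
    and B: "(\<integral>\<^sup>+x. ennreal (b x powr t) \<partial>M) \<le> ennreal (B powr t)"
  shows "(\<integral>\<^sup>+x. ennreal (a x * b x) \<partial>M) \<le> ennreal (A * B)"
proof -
  \<comment> \<open>These are the coefficients that arise when Young's inequality for
    \<open>a x / A\<close> and \<open>b x / B\<close> is multiplied by \<open>A * B\<close>. After
    integration the two terms are at most \<open>A * B / s\<close> and
    \<open>A * B / t\<close>.\<close>
  define \<alpha> \<beta> where "\<alpha> = A * B / (s * A powr s)" and "\<beta> = A * B / (t * B powr t)"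
  have ab: "0 \<le> \<alpha>" "0 \<le> \<beta>"
    using pos st by (auto simp: \<alpha>_def \<beta>_def)
  have young: "a x * b x \<le> \<alpha> * a x powr s + \<beta> * b x powr t" for x
  proof -
    have "(a x / A) * (b x / B) \<le> (a x / A) powr s / s + (b x / B) powr t / t"
      using st pos nonneg by (intro Youngs_inequality) auto
    then have "A * B * ((a x / A) * (b x / B)) \<le> A * B * ((a x / A) powr s / s + (b x / B) powr t / t)"
      using pos by (intro mult_left_mono) auto
    then show ?thesis
      using pos st nonneg[of x]
      by (simp add: \<alpha>_def \<beta>_def powr_divide distrib_left mult.commute)
  qed
  have "(\<integral>\<^sup>+x. ennreal (a x * b x) \<partial>M)
      \<le> (\<integral>\<^sup>+x. ennreal \<alpha> * ennreal (a x powr s) + ennreal \<beta> * ennreal (b x powr t) \<partial>M)"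
    using young ab by (intro nn_integral_mono) (simp flip: ennreal_mult ennreal_plus)
  also have "\<dots> = ennreal \<alpha> * (\<integral>\<^sup>+x. ennreal (a x powr s) \<partial>M)
      + ennreal \<beta> * (\<integral>\<^sup>+x. ennreal (b x powr t) \<partial>M)"
    by (simp add: nn_integral_add nn_integral_cmult)
  also have "\<dots> \<le> ennreal \<alpha> * ennreal (A powr s) + ennreal \<beta> * ennreal (B powr t)"
    by (intro add_mono mult_left_mono A B) auto
  also have "\<dots> = ennreal (A * B * (1 / s + 1 / t))"
    using ab pos st by (simp add: \<alpha>_def \<beta>_def field_simps flip: ennreal_mult ennreal_plus)
  finally show ?thesis
    by (simp add: st)
qed

text \<open>Later estimates bound the integral of the power, so that roots and infinite integrals
  are dealt with once, here.\<close>

lemma Lp_norm_le_iff: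
  assumes s: "1 \<le> s" "s \<noteq> \<infinity>" and A: "0 \<le> A"
  shows "Lp_norm s f \<le> ennreal A
    \<longleftrightarrow> (\<integral>\<^sup>+x. ennreal (norm (f x) powr enn2real s) \<partial>lebesgue) \<le> ennreal (A powr enn2real s)"
proof (cases "\<integral>\<^sup>+x. ennreal (norm (f x) powr enn2real s) \<partial>lebesgue")
  case (real i)
  have s1: "1 \<le> enn2real s"
    using s by (cases s) auto
  have "i powr (1 / enn2real s) \<le> A \<longleftrightarrow> i \<le> A powr enn2real s"
  proof
    assume "i powr (1 / enn2real s) \<le> A"
    then have "(i powr (1 / enn2real s)) powr enn2real s \<le> A powr enn2real s"
      using s1 by (intro powr_mono2) auto
    then show "i \<le> A powr enn2real s"
      using s1 real(1) by (simp add: powr_powr)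
  next
    assume "i \<le> A powr enn2real s"
    then have "i powr (1 / enn2real s) \<le> (A powr enn2real s) powr (1 / enn2real s)"
      using s1 real(1) by (intro powr_mono2) auto
    then show "i powr (1 / enn2real s) \<le> A"
      using s1 A by (simp add: powr_powr)
  qed
  then show ?thesis
    using s real A by (simp add: Lp_norm_def)
next
  case top
  then show ?thesis
    using s by (simp add: Lp_norm_def top_unique)
qed

lemma Lp_norm_one: "Lp_norm 1 f = (\<integral>\<^sup>+x. ennreal (norm (f x)) \<partial>lebesgue)"
  by (cases "\<integral>\<^sup>+x. ennreal (norm (f x)) \<partial>lebesgue") (simp_all add: Lp_norm_def)

lemma Lp_norm_top_le_iff:
  assumes "f \<in> borel_measurable lebesgue" "0 \<le> A"
  shows "Lp_norm top f \<le> ennreal A \<longleftrightarrow> (AE x in lebesgue. norm (f x) \<le> A)"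
proof
  assume "Lp_norm top f \<le> ennreal A"
  then show "AE x in lebesgue. norm (f x) \<le> A"
    using esssup_AE[of "\<lambda>x. ennreal (norm (f x))" lebesgue] assms(2)
    by (auto simp: Lp_norm_def simp flip: ennreal_le_iff elim!: eventually_mono)
next
  assume "AE x in lebesgue. norm (f x) \<le> A"
  then show "Lp_norm top f \<le> ennreal A"
    using assms by (auto simp: Lp_norm_def intro!: esssup_I elim!: eventually_mono)
qed

subsection \<open>Inequalities of Hoelder and Young\<close>

text \<open>The value 0 is excluded because \<open>1 / 0\<close> is infinite, and an infinite
  exponent has partner 1 because its reciprocal is 0. If both are finite, each reciprocal is
  positive and hence below 1.\<close>

lemma conjugate_ennreal_cases:
  fixes s t :: ennreal
  assumes "1 / s + 1 / t = 1"
  obtains "s = 1" "t = \<infinity>" | "s = \<infinity>" "t = 1"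
    | a b where "s = ennreal a" "t = ennreal b" "1 < a" "1 < b" "1 / a + 1 / b = 1"
proof -
  have s0: "s \<noteq> 0" and t0: "t \<noteq> 0"
    using assms by (auto simp: ennreal_divide_zero)
  show thesis
  proof (cases s)
    case top
    have "1 / t = 1"
      using assms top by simp
    then have "t = 1"
      using t0 by (cases t) (auto simp: divide_ennreal simp flip: ennreal_1)
    then show thesis
      using that(2) top by simp
  next
    case (real a)
    then have a: "0 < a" "1 / s = ennreal (1 / a)"
      using s0 by (auto simp: divide_ennreal less_le simp flip: ennreal_1)
    show thesis
    proof (cases t)
      case top
      then have "1 / a = 1"
        using assms a by (auto simp flip: ennreal_1)
      then show thesis
        using that(1) real top by simp
    next
      case (real b)
      then have b: "0 < b" "1 / t = ennreal (1 / b)"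
        using t0 by (auto simp: divide_ennreal less_le simp flip: ennreal_1)
      have ab: "1 / a + 1 / b = 1"
        using assms a b by (simp flip: ennreal_plus ennreal_1)
      then have "1 / a < 1" "1 / b < 1"
        using a(1) b(1) by (smt (verit) divide_pos_pos)+
      then show thesis
        using that(3)[OF \<open>s = ennreal a\<close> \<open>t = ennreal b\<close> _ _ ab] a b by auto
    qed
  qed
qed

lemma Lp_Hoelder:
  assumes [measurable]: "k \<in> borel_measurable lebesgue" "f \<in> borel_measurable lebesgue"
    and st: "1 / s + 1 / t = 1"
    and pos: "0 < A" "0 < B"
    and A: "Lp_norm s k \<le> ennreal A" and B: "Lp_norm t f \<le> ennreal B"
  shows "(\<integral>\<^sup>+y. ennreal (norm (k y) * norm (f y)) \<partial>lebesgue) \<le> ennreal (A * B)"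
proof -
  \<comment> \<open>The endpoint pair of exponents, for arbitrary \<open>g\<close> and
    \<open>h\<close> so that it serves with \<open>k\<close> and \<open>f\<close> in either
    order.\<close>
  have inf_one: "(\<integral>\<^sup>+y. ennreal (norm (g y) * norm (h y)) \<partial>lebesgue) \<le> ennreal (C * D)"
    if [measurable]: "g \<in> borel_measurable lebesgue" "h \<in> borel_measurable lebesgue"
      and "0 < C" "0 < D" "Lp_norm \<infinity> g \<le> ennreal C" "Lp_norm 1 h \<le> ennreal D" for g h C D
  proof -
    have "AE y in lebesgue. norm (g y) \<le> C"
      using that by (simp add: Lp_norm_top_le_iff)
    then have "(\<integral>\<^sup>+y. ennreal (norm (g y) * norm (h y)) \<partial>lebesgue)
        \<le> (\<integral>\<^sup>+y. ennreal C * ennreal (norm (h y)) \<partial>lebesgue)"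
      using \<open>0 < C\<close>
      by (intro nn_integral_mono_AE) (auto elim!: eventually_mono intro!: mult_right_mono simp flip: ennreal_mult)
    also have "\<dots> = ennreal C * Lp_norm 1 h"
      by (simp add: nn_integral_cmult Lp_norm_one)
    also have "\<dots> \<le> ennreal C * ennreal D"
      by (intro mult_left_mono that) simp
    finally show ?thesis
      using that by (simp add: ennreal_mult)
  qed
  from st show ?thesis
  proof (cases rule: conjugate_ennreal_cases)
    case 1
    then show ?thesis
      using inf_one[of f k B A] assms by (simp add: mult.commute)
  next
    case 2
    then show ?thesis
      using inf_one[of k f A B] assms by simp
  next
    case (3 a b)
    show ?thesis
    proof (rule nn_integral_Hoelder[OF _ _ _ _ 3(3-5) pos])
      show "(\<integral>\<^sup>+x. ennreal (norm (k x) powr a) \<partial>lebesgue) \<le> ennreal (A powr a)"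
        using A Lp_norm_le_iff[of s A k] 3 pos by simp
      show "(\<integral>\<^sup>+x. ennreal (norm (f x) powr b) \<partial>lebesgue) \<le> ennreal (B powr b)"
        using B Lp_norm_le_iff[of t B f] 3 pos by simp
    qed auto
  qed
qed

lemma Lp_norm_reflect_le:
  assumes k: "k \<in> borel_measurable lebesgue" and s: "1 \<le> s" and A: "0 \<le> A"
    and le: "Lp_norm s k \<le> ennreal A"
  shows "Lp_norm s (\<lambda>y. k (x - y)) \<le> ennreal A"
proof (cases "s = \<infinity>")
  case True
  then have "AE y in lebesgue. norm (k y) \<le> A"
    using le k A by (simp add: Lp_norm_top_le_iff)
  then have "AE y in lebesgue. norm (k (x - y)) \<le> A"
    by (rule AE_reflect)
  then show ?thesis
    using True A borel_measurable_reflect[OF k] by (simp add: Lp_norm_top_le_iff)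
next
  case False
  have "(\<integral>\<^sup>+y. ennreal (norm (k (x - y)) powr enn2real s) \<partial>lebesgue)
      = (\<integral>\<^sup>+y. ennreal (norm (k y) powr enn2real s) \<partial>lebesgue)"
    by (rule nn_integral_reflect[of "\<lambda>y. ennreal (norm (k y) powr enn2real s)"]) (use k in measurable)
  then show ?thesis
    using le s A False by (simp add: Lp_norm_le_iff)
qed

lemma Lp_Hoelder_reflect:
  assumes k: "k \<in> borel_measurable lebesgue" and f: "f \<in> borel_measurable lebesgue"
    and s: "1 \<le> s" and st: "1 / s + 1 / t = 1"
    and pos: "0 < A" "0 < B"
    and A: "Lp_norm s k \<le> ennreal A" and B: "Lp_norm t f \<le> ennreal B"
  shows "(\<integral>\<^sup>+y. ennreal (norm (k (x - y)) * norm (f y)) \<partial>lebesgue) \<le> ennreal (A * B)"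
  using Lp_norm_reflect_le[OF k s _ A] pos
  by (intro Lp_Hoelder[OF borel_measurable_reflect[OF k] f st pos _ B]) simp

text \<open>One bound on the integral of absolute values yields both the existence of the
  convolution at \<open>x\<close> and its size there.\<close>

lemma norm_conv_le:
  assumes "k \<in> borel_measurable lebesgue" "f \<in> borel_measurable lebesgue"
    and le: "(\<integral>\<^sup>+y. ennreal (norm (k (x - y)) * norm (f y)) \<partial>lebesgue) \<le> ennreal A" and "0 \<le> A"
  shows "integrable lebesgue (\<lambda>y. k (x - y) * f y)" and "norm (conv k f x) \<le> A"
proof -
  have [measurable]: "(\<lambda>y. k (x - y)) \<in> borel_measurable lebesgue" "f \<in> borel_measurable lebesgue"
    using borel_measurable_reflect assms by auto
  have "(\<lambda>y. k (x - y) * f y) \<in> borel_measurable lebesgue"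
    by measurable
  moreover have "(\<integral>\<^sup>+y. ennreal (norm (k (x - y) * f y)) \<partial>lebesgue) < \<infinity>"
    using le by (auto simp: norm_mult intro: le_less_trans)
  ultimately show int: "integrable lebesgue (\<lambda>y. k (x - y) * f y)"
    by (rule integrableI_bounded)
  have "ennreal (norm (conv k f x)) \<le> ennreal A"
    using integral_norm_bound_ennreal[OF int] le by (auto simp: conv_def norm_mult intro: order_trans)
  then show "norm (conv k f x) \<le> A"
    using \<open>0 \<le> A\<close> by simp
qed

text \<open>For \<open>v > 1\<close> this is Hoelder's inequality for \<open>\<bar>k\<bar> \<bar>f\<bar>\<^bsup>1/v\<^esup> \<cdot> \<bar>f\<bar>\<^bsup>1-1/v\<^esup>\<close>. The integral on the right
  may vanish, hence the detour through \<open>e > 0\<close>.\<close>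

lemma norm_conv_powr_le:
  assumes k: "k \<in> borel_measurable lebesgue" and f: "f \<in> borel_measurable lebesgue"
    and v: "1 \<le> v" and B: "0 < B" "Lp_norm 1 f \<le> ennreal B"
  shows "ennreal (norm (conv k f x) powr v) \<le> ennreal (B powr (v - 1)) *
    (\<integral>\<^sup>+y. ennreal (norm (k (x - y)) powr v) * ennreal (norm (f y)) \<partial>lebesgue)"
    (is "_ \<le> _ * ?M")
proof (cases ?M)
  case top
  then show ?thesis
    using B by (simp add: ennreal_mult_top)
next
  case (real m)
  have [measurable]: "(\<lambda>y. k (x - y)) \<in> borel_measurable lebesgue" "f \<in> borel_measurable lebesgue"
    using borel_measurable_reflect k f by auto
  have bound: "(\<integral>\<^sup>+y. ennreal (norm (k (x - y)) * norm (f y)) \<partial>lebesgue)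
      \<le> ennreal ((m + e) powr (1 / v) * B powr (1 - 1 / v))" if e: "0 < e" for e
  proof (cases "v = 1")
    case True
    have "?M \<le> ennreal (m + e)"
      using real e by simp
    then show ?thesis
      using True real e B by (simp flip: ennreal_mult)
  next
    case False
    with v have v1: "1 < v"
      by simp
    define t where "t = v / (v - 1)"
    have t: "1 < t" "1 / v + 1 / t = 1" "1 / t = 1 - 1 / v"
      using v1 by (auto simp: t_def field_simps)
    have "(\<integral>\<^sup>+y. ennreal ((norm (k (x - y)) * norm (f y) powr (1 / v)) * norm (f y) powr (1 / t)) \<partial>lebesgue)
        \<le> ennreal ((m + e) powr (1 / v) * B powr (1 / t))"
    proof (rule nn_integral_Hoelder[OF _ _ _ _ v1 t(1,2)])
      show "0 < (m + e) powr (1 / v)" "0 < B powr (1 / t)"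
        using real e B by auto
      have "(norm (k (x - y)) * norm (f y) powr (1 / v)) powr v = norm (k (x - y)) powr v * norm (f y)" for y
        using v1 by (simp add: powr_mult powr_powr)
      then show "(\<integral>\<^sup>+y. ennreal ((norm (k (x - y)) * norm (f y) powr (1 / v)) powr v) \<partial>lebesgue)
          \<le> ennreal (((m + e) powr (1 / v)) powr v)"
        using real e v1 by (simp add: powr_powr ennreal_mult)
      show "(\<integral>\<^sup>+y. ennreal ((norm (f y) powr (1 / t)) powr t) \<partial>lebesgue) \<le> ennreal ((B powr (1 / t)) powr t)"
        using B t(1) by (simp add: powr_powr Lp_norm_one)
    qed auto
    moreover have "norm (f y) powr (1 / v) * norm (f y) powr (1 / t) = norm (f y)" for y
      using t(2) by (simp flip: powr_add)
    ultimately show ?thesis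
      using t(3) by (simp add: mult.assoc)
  qed
  show ?thesis
  proof (rule ennreal_le_epsilon)
    fix e :: real assume e: "0 < e"
    \<comment> \<open>Chosen so that the error \<open>d\<close> becomes exactly \<open>e\<close>
      after multiplication by \<open>B powr (v - 1)\<close>.\<close>
    define d where "d = e / B powr (v - 1)"
    have d: "0 < d"
      using e B by (simp add: d_def)
    have "norm (conv k f x) \<le> (m + d) powr (1 / v) * B powr (1 - 1 / v)"
      by (rule norm_conv_le(2)[OF k f bound[OF d]]) simp
    then have "norm (conv k f x) powr v \<le> ((m + d) powr (1 / v) * B powr (1 - 1 / v)) powr v"
      using v by (intro powr_mono2) auto
    also have "\<dots> = (m + d) * B powr (v - 1)"
    proof -
      have "(1 - 1 / v) * v = v - 1"
        using v by (simp add: field_simps)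
      then show ?thesis
        using v real d by (simp add: powr_mult powr_powr)
    qed
    also have "\<dots> = B powr (v - 1) * m + e"
      using B by (simp add: d_def field_simps)
    finally show "ennreal (norm (conv k f x) powr v) \<le> ennreal (B powr (v - 1)) * ?M + ennreal e"
      using real e by (simp flip: ennreal_mult ennreal_plus)
  qed
qed

text \<open>Young's inequality with one factor in L^1. The pointwise bound
  \<open>norm_conv_powr_le\<close> is integrated by Tonelli's theorem, and the factors
  \<open>A powr v\<close>, \<open>B powr (v - 1)\<close> and \<open>B\<close> combine to
  \<open>(A * B) powr v\<close>. For infinite \<open>\<nu>\<close> it is Hoelder's inequality at the
  endpoint.\<close>

lemma Lp_norm_conv_le:
  assumes k: "k \<in> borel_measurable lebesgue" and f: "f \<in> borel_measurable lebesgue"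
    and \<nu>: "1 \<le> \<nu>" and pos: "0 < A" "0 < B"
    and A: "Lp_norm \<nu> k \<le> ennreal A" and B: "Lp_norm 1 f \<le> ennreal B"
  shows "Lp_norm \<nu> (conv k f) \<le> ennreal (A * B)"
proof (cases "\<nu> = \<infinity>")
  case True
  have "norm (conv k f x) \<le> A * B" for x
    using Lp_Hoelder_reflect[OF k f \<nu> _ pos A B] True pos
    by (intro norm_conv_le(2)[OF k f]) auto
  then show ?thesis
    using True pos borel_measurable_conv[OF k f] by (simp add: Lp_norm_top_le_iff)
next
  case False
  define v where "v = enn2real \<nu>"
  have v: "1 \<le> v"
    using \<nu> False by (cases \<nu>) (auto simp: v_def)
  note [measurable] = k f
  have "(\<integral>\<^sup>+x. ennreal (norm (conv k f x) powr v) \<partial>lebesgue)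
      \<le> (\<integral>\<^sup>+x. ennreal (B powr (v - 1)) *
          (\<integral>\<^sup>+y. ennreal (norm (k (x - y)) powr v) * ennreal (norm (f y)) \<partial>lebesgue) \<partial>lebesgue)"
    by (intro nn_integral_mono norm_conv_powr_le k f v pos B)
  also have "\<dots> = (\<integral>\<^sup>+x. \<integral>\<^sup>+y. ennreal (norm (k (x - y)) powr v) *
      (ennreal (B powr (v - 1)) * ennreal (norm (f y))) \<partial>lebesgue \<partial>lebesgue)"
    by (intro nn_integral_cong)
      (subst nn_integral_cmult[symmetric],
        use borel_measurable_reflect[OF k] in \<open>auto intro!: nn_integral_cong simp: ac_simps\<close>)
  also have "\<dots> = (\<integral>\<^sup>+x. ennreal (norm (k x) powr v) \<partial>lebesgue) *
      (\<integral>\<^sup>+y. ennreal (B powr (v - 1)) * ennreal (norm (f y)) \<partial>lebesgue)"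
    by (rule nn_integral_conv) measurable
  also have "\<dots> = (\<integral>\<^sup>+x. ennreal (norm (k x) powr v) \<partial>lebesgue) * (ennreal (B powr (v - 1)) * Lp_norm 1 f)"
    by (simp add: nn_integral_cmult Lp_norm_one)
  also have "\<dots> \<le> ennreal (A powr v) * (ennreal (B powr (v - 1)) * ennreal B)"
    using A \<nu> False pos by (intro mult_mono B) (auto simp: Lp_norm_le_iff v_def)
  also have "\<dots> = ennreal ((A * B) powr v)"
    using pos by (simp add: powr_mult powr_diff flip: ennreal_mult)
  finally show ?thesis
    using \<nu> False pos by (simp add: Lp_norm_le_iff v_def)
qed

subsection \<open>The modular and interpolation\<close>

lemma omega_mod_mono:
  assumes "0 \<le> s" "s \<le> t"
  shows "omega_mod p s \<le> omega_mod p t"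
  using assms by (auto simp: omega_mod_def intro!: ennreal_leI powr_mono2)

text \<open>Convexity along rays from 0, where \<open>omega_mod p\<close> vanishes. It allows a
  finite modular to be scaled down below 1.\<close>

lemma omega_mod_scale_le:
  assumes "1 \<le> p" "0 < t" "t \<le> 1" "0 \<le> u"
  shows "omega_mod p (t * u) \<le> ennreal t * omega_mod p u"
proof (cases p)
  case (real a)
  then have a: "1 \<le> a"
    using assms(1) by simp
  have "(t * u) powr a \<le> t * u powr a"
    using powr_mono'[of 1 a t] a assms by (auto simp: powr_mult intro!: mult_right_mono)
  then show ?thesis
    using real assms by (simp add: omega_mod_def flip: ennreal_mult)
next
  case top
  then show ?thesis
    using assms mult_mono[of t 1 u 1] by (auto simp: omega_mod_def ennreal_mult_top)
qed

lemma borel_measurable_omega_mod: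
  assumes [measurable]: "p \<in> borel_measurable M" "u \<in> borel_measurable M"
  shows "(\<lambda>x. omega_mod (p x) (u x)) \<in> borel_measurable M"
  unfolding omega_mod_def by measurable

text \<open>The strict inequality provides an admissible \<open>l'\<close> below \<open>l\<close>,
  so it does not matter whether the infimum is attained; monotonicity then passes from
  \<open>l'\<close> to \<open>l\<close>.\<close>

lemma modular_le_one:
  assumes "Lvar_norm p f < ennreal l"
  shows "modular p (\<lambda>x. f x / complex_of_real l) \<le> 1"
proof -
  obtain l' where l': "0 < l'" "modular p (\<lambda>x. f x / complex_of_real l') \<le> 1" "l' < l"
    using assms by (auto simp: Lvar_norm_def Inf_less_iff ennreal_less_iff)
  have "modular p (\<lambda>x. f x / complex_of_real l) \<le> modular p (\<lambda>x. f x / complex_of_real l')"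
    unfolding modular_def using l'
    by (intro nn_integral_mono omega_mod_mono) (auto simp: norm_divide intro!: divide_left_mono)
  then show ?thesis
    using l'(2) by simp
qed

lemma Lvar_norm_le:
  assumes "0 < l" "modular p (\<lambda>x. f x / complex_of_real l) \<le> 1"
  shows "Lvar_norm p f \<le> ennreal l"
  unfolding Lvar_norm_def by (rule Inf_lower) (use assms in auto)

lemma Lvar_norm_finite:
  assumes p: "p \<in> var_exponents" and f: "f \<in> Lvar p"
  shows "Lvar_norm p f < \<infinity>"
proof -
  obtain l where l: "0 < l" "modular p (\<lambda>x. complex_of_real l * f x) < \<infinity>"
    using f by (auto simp: Lvar_def)
  define M where "M = modular p (\<lambda>x. complex_of_real l * f x)"
  \<comment> \<open>This makes both \<open>t\<close> and \<open>t * M\<close> at most 1; the maximum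
    covers a modular below 1, including 0.\<close>
  define t where "t = 1 / max 1 (enn2real M)"
  have t: "0 < t" "t \<le> 1"
    by (auto simp: t_def)
  have M: "M = ennreal (enn2real M)"
    using l by (simp add: M_def less_top)
  have "omega_mod (p x) (norm (f x / complex_of_real (1 / (t * l))))
      \<le> ennreal t * omega_mod (p x) (norm (complex_of_real l * f x))" for x
    using omega_mod_scale_le[of "p x" t "norm (complex_of_real l * f x)"] t l p
    by (simp add: var_exponents_def norm_mult norm_divide ac_simps)
  then have "modular p (\<lambda>x. f x / complex_of_real (1 / (t * l)))
      \<le> (\<integral>\<^sup>+x. ennreal t * omega_mod (p x) (norm (complex_of_real l * f x)) \<partial>lebesgue)"
    unfolding modular_def by (rule nn_integral_mono)
  also have "\<dots> = ennreal t * M"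
    unfolding M_def modular_def
    by (intro nn_integral_cmult borel_measurable_omega_mod)
      (use p f in \<open>auto simp: var_exponents_def Lvar_def\<close>)
  also have "\<dots> \<le> 1"
    by (subst M) (auto simp: t_def simp flip: ennreal_mult)
  finally have "Lvar_norm p f \<le> ennreal (1 / (t * l))"
    using t l by (intro Lvar_norm_le) auto
  then show ?thesis
    by (auto intro: le_less_trans)
qed

text \<open>The exponent \<open>\<rho>\<close> is a bound for \<open>r\<close> on the side on which it is needed to control \<open>(A / L)\<^bsup>r(x)\<^esup>\<close>,
  where \<open>A / L = (A / B)\<^bsup>\<nu>/\<rho>\<^esup>\<close>. If \<open>\<nu> = \<infinity>\<close> then \<open>\<rho> = \<infinity>\<close>, \<open>\<nu> / \<rho> = 0\<close> and \<open>B\<close> is irrelevant.\<close>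

lemma modular_interpolation:
  fixes r :: "real ^ 'n \<Rightarrow> ennreal" and \<nu> \<rho> :: ennreal and A B :: real
  defines "\<beta> \<equiv> enn2real (\<nu> / \<rho>)"
  defines "L \<equiv> A powr (1 - \<beta>) * B powr \<beta>"
  assumes \<nu>: "1 \<le> \<nu>" "\<nu> \<le> \<rho>" "AE x in lebesgue. \<nu> \<le> r x"
    and pos: "0 < A" "0 < B"
    and [measurable]: "g \<in> borel_measurable lebesgue"
    and gA: "AE x in lebesgue. norm (g x) \<le> A"
    and gB: "Lp_norm \<nu> g \<le> ennreal B"
    and \<rho>: "A \<le> B \<and> (AE x in lebesgue. \<rho> \<le> r x) \<or> B \<le> A \<and> (AE x in lebesgue. r x \<le> \<rho>)"
  shows "modular r (\<lambda>x. g x / complex_of_real L) \<le> 1"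
proof (cases "\<nu> = \<infinity>")
  case True
  with \<nu> have "\<rho> = \<infinity>"
    by (simp add: top_unique)
  then have L: "L = A"
    using pos by (simp add: L_def \<beta>_def)
  have "AE x in lebesgue. omega_mod (r x) (norm (g x / complex_of_real L)) = 0"
    using \<nu>(3) gA by eventually_elim (use True pos L in \<open>auto simp: omega_mod_def norm_divide top_unique\<close>)
  then have "modular r (\<lambda>x. g x / complex_of_real L) = (\<integral>\<^sup>+x. 0 \<partial>(lebesgue :: (real ^ 'n) measure))"
    unfolding modular_def by (rule nn_integral_cong_AE)
  then show ?thesis
    by simp
next
  case False
  define v where "v = enn2real \<nu>"
  have v: "1 \<le> v" "\<nu> = ennreal v"
    using \<nu>(1) False by (cases \<nu>; auto simp: v_def)+
  have L0: "0 < L"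
    using pos by (simp add: L_def)
  have AL: "A / L = (A / B) powr \<beta>"
    using pos by (simp add: L_def powr_diff powr_divide)
  have \<beta>_top: "\<beta> = 0" if "\<rho> = \<infinity>"
    using that by (simp add: \<beta>_def)
  have \<beta>_real: "\<beta> = v / \<rho>'" "0 < \<rho>'" if "\<rho> = ennreal \<rho>'" "0 \<le> \<rho>'" for \<rho>'
  proof -
    have "v \<le> \<rho>'"
      using \<nu>(2) that v by simp
    then show "\<beta> = v / \<rho>'" "0 < \<rho>'"
      using v that by (auto simp: \<beta>_def divide_ennreal)
  qed
  have \<beta>0: "0 \<le> \<beta>"
    by (simp add: \<beta>_def)
  have pointwise: "omega_mod (r x) (norm (g x / complex_of_real L))
      \<le> ennreal (1 / B powr v) * ennreal (norm (g x) powr v)"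
    if x: "\<nu> \<le> r x" "norm (g x) \<le> A" "A \<le> B \<and> \<rho> \<le> r x \<or> B \<le> A \<and> r x \<le> \<rho>" for x
  proof (cases "r x")
    case (real R)
    have R: "v \<le> R"
      using x(1) real v by simp
    \<comment> \<open>By \<open>AL\<close> the left side is
      \<open>(A / B) powr (\<beta> * R)\<close>. A base below 1 calls for
      \<open>v \<le> \<beta> * R\<close>, a base above 1 for the reverse; the two alternatives for
      \<open>\<rho>\<close> supply exactly these.\<close>
    have "(A / L) powr R \<le> (A / B) powr v"
    proof (cases "A \<le> B")
      case True
      have "v \<le> \<beta> * R"
        if le: "\<rho> \<le> r x"
      proof (cases \<rho>)
        case (real \<rho>')
        then have "\<rho>' \<le> R"
          using le \<open>r x = ennreal R\<close> \<open>0 \<le> R\<close> by simp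
        then have "v * \<rho>' \<le> v * R"
          using v by simp
        then show ?thesis
          using \<beta>_real(2)[OF real(2,1)] unfolding \<beta>_real(1)[OF real(2,1)] by (simp add: field_simps)
      next
        case top
        then show ?thesis
          using le real by (simp add: top_unique)
      qed
      \<comment> \<open>For equal bounds the second alternative for \<open>\<rho>\<close> may be the
        one that holds, which gives no lower bound on \<open>r x\<close>; but then both powers are
        1.\<close>
      moreover have ?thesis if "A = B"
        using that pos AL by simp
      ultimately show ?thesis
        using x(3) True pos AL by (cases "A = B") (auto simp: powr_powr intro!: powr_mono')
    next
      case False
      then have le: "r x \<le> \<rho>"
        using x(3) by auto
      have "\<beta> * R \<le> v"
      proof (cases \<rho>)
        case (real \<rho>')
        then have "R \<le> \<rho>'"
          using le \<open>r x = ennreal R\<close> \<open>0 \<le> R\<close> by simp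
        then have "v * R \<le> v * \<rho>'"
          using v by simp
        then show ?thesis
          using \<beta>_real(2)[OF real(2,1)] unfolding \<beta>_real(1)[OF real(2,1)] by (simp add: field_simps)
      next
        case top
        then show ?thesis
          using \<beta>_top v by simp
      qed
      then show ?thesis
        using False pos AL by (auto simp: powr_powr intro!: powr_mono)
    qed
    moreover have "(norm (g x) / A) powr R \<le> (norm (g x) / A) powr v"
      using x(2) pos R by (intro powr_mono') auto
    ultimately have "(norm (g x) / A) powr R * (A / L) powr R \<le> (norm (g x) / A) powr v * (A / B) powr v"
      by (intro mult_mono) auto
    then have "(norm (g x) / L) powr R \<le> (norm (g x) / B) powr v"
      using pos L0 by (simp flip: powr_mult)
    then show ?thesis
      using real L0 pos by (simp add: omega_mod_def norm_divide powr_divide flip: ennreal_mult)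
  next
    case top
    \<comment> \<open>At an infinite exponent the modular asks for
      \<open>norm (g x) \<le> L\<close>. If \<open>B < A\<close>, then
      \<open>r x \<le> \<rho>\<close> forces \<open>\<rho>\<close> to be infinite, so
      \<open>\<beta>\<close> is 0 and \<open>L = A\<close>.\<close>
    have "A \<le> L"
    proof (cases "A \<le> B")
      case True
      then have "A / L \<le> 1"
        unfolding AL using pos \<beta>0 by (intro powr_le1) auto
      then show ?thesis
        using L0 by simp
    next
      case False
      then have "\<rho> = \<infinity>"
        using x(3) top by (simp add: top_unique)
      then show ?thesis
        using \<beta>_top pos by (simp add: L_def)
    qed
    then show ?thesis
      using top x(2) L0 by (simp add: omega_mod_def norm_divide)
  qed
  have "modular r (\<lambda>x. g x / complex_of_real L)
      \<le> (\<integral>\<^sup>+x. ennreal (1 / B powr v) * ennreal (norm (g x) powr v) \<partial>lebesgue)"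
    unfolding modular_def
  proof (rule nn_integral_mono_AE)
    have "AE x in lebesgue. A \<le> B \<and> \<rho> \<le> r x \<or> B \<le> A \<and> r x \<le> \<rho>"
      using \<rho> by auto
    with \<nu>(3) gA show "AE x in lebesgue. omega_mod (r x) (norm (g x / complex_of_real L))
        \<le> ennreal (1 / B powr v) * ennreal (norm (g x) powr v)"
      by eventually_elim (rule pointwise)
  qed
  also have "\<dots> = ennreal (1 / B powr v) * (\<integral>\<^sup>+x. ennreal (norm (g x) powr v) \<partial>lebesgue)"
    by (rule nn_integral_cmult) measurable
  also have "\<dots> \<le> ennreal (1 / B powr v) * ennreal (B powr v)"
    using gB pos \<nu>(1) False by (intro mult_left_mono) (simp_all add: Lp_norm_le_iff v_def)
  also have "\<dots> = 1"
    using pos by (simp flip: ennreal_mult)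
  finally show ?thesis .
qed

section \<open>Conjugates of constant exponents\<close>

lemma conjugate_exists:
  fixes s :: ennreal
  assumes "1 \<le> s"
  obtains t where "1 \<le> t" "1 / t + 1 / s = 1"
proof (cases s)
  case top
  then show thesis
    using that[of 1] by simp
next
  case (real a)
  then have a: "1 \<le> a"
    using assms by simp
  show thesis
  proof (cases "a = 1")
    case True
    then show thesis
      using that[of \<infinity>] real by simp
  next
    case False
    with a have "1 < a"
      by simp
    then have "1 / ennreal (a / (a - 1)) + 1 / s = 1" "1 \<le> a / (a - 1)"
      using real by (simp_all add: divide_ennreal field_simps flip: ennreal_plus ennreal_1)
    then show thesis
      using that[of "ennreal (a / (a - 1))"] by simp
  qed
qed

lemma enn2real_conjugate:
  fixes s t :: ennreal
  assumes "1 / s + 1 / t = 1"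
  shows "1 - enn2real (1 / s) = enn2real (1 / t)"
  using assms by (cases rule: conjugate_ennreal_cases) (auto simp: divide_ennreal simp flip: ennreal_1)

subsection \<open>The kernels\<close>

lemma borel_measurable_eta [measurable]: "eta t m \<in> borel_measurable lebesgue"
  unfolding eta_def by (rule measurable_completion) measurable

lemma norm_eta:
  fixes x :: "real ^ 'n"
  shows "0 < t \<Longrightarrow> norm (eta t m x) = t powr (- real CARD('n)) * (1 + norm x / t) powr (- m)"
  by (simp add: eta_def norm_mult)

lemma norm_eta_le:
  fixes x :: "real ^ 'n"
  assumes "0 < t" "0 \<le> m"
  shows "norm (eta t m x) \<le> t powr (- real CARD('n))"
proof -
  have "0 < 1 + norm x / t"
    using assms by (simp add: add_pos_nonneg)
  then have "(1 + norm x / t) powr (- m) \<le> 1"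
    using assms powr_mono[of "- m" 0 "1 + norm x / t"] by (simp split: if_splits)
  then show ?thesis
    using assms(1) by (simp add: norm_eta mult_left_le)
qed

lemma dyadic_shell:
  fixes u :: real
  assumes "1 \<le> u"
  obtains k :: nat where "2 ^ k \<le> u" "u < 2 ^ Suc k"
proof -
  define k where "k = (LEAST k. u < 2 ^ Suc k)"
  obtain n where "u < 2 ^ n"
    using real_arch_pow[of 2 u] by auto
  then have "u < 2 ^ Suc n"
    by (rule less_trans) simp
  then have "u < 2 ^ Suc k"
    unfolding k_def by (rule LeastI)
  moreover have "2 ^ k \<le> u"
  proof (cases k)
    case (Suc j)
    then have "\<not> u < 2 ^ Suc j"
      using not_less_Least[of j "\<lambda>k. u < 2 ^ Suc k"] by (simp add: k_def)
    then show ?thesis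
      using Suc by simp
  qed (use assms in simp)
  ultimately show thesis
    using that by blast
qed

text \<open>On the shell \<open>2\<^bsup>k\<^esup> \<le> 1 + \<bar>x\<bar> / t < 2\<^bsup>k+1\<^esup>\<close> the kernel is at most \<open>t\<^bsup>-n\<^esup> 2\<^bsup>-km\<^esup>\<close>, and the volume is of
  order \<open>t\<^bsup>n\<^esup> 2\<^bsup>kn\<^esup>\<close>; the resulting geometric series converges since \<open>m > n\<close>.\<close>

lemma Lp_norm_one_eta:
  assumes m: "m > real CARD('n)"
  obtains c where "1 \<le> c"
    "\<And>t. 0 < t \<Longrightarrow> Lp_norm 1 (eta t m :: real ^ 'n \<Rightarrow> complex) \<le> ennreal c"
proof -
  define n where "n = CARD('n)"
  define V where "V = unit_ball_vol (real n)"
  define q :: real where "q = 2 powr (real n - m)"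
  have V: "0 \<le> V"
    by (simp add: V_def)
  have "2 powr (real n - m) < 2 powr (0 :: real)"
    using m by (intro powr_less_mono) (auto simp: n_def)
  then have q: "0 < q" "q < 1"
    by (auto simp: q_def)
  \<comment> \<open>The sum of the geometric series, raised to at least 1 so that
    \<open>c \<le> c powr v\<close> is available later.\<close>
  define c where "c = max 1 (V * 2 ^ n / (1 - q))"
  have "Lp_norm 1 (eta t m :: real ^ 'n \<Rightarrow> complex) \<le> ennreal c" if t: "0 < t" for t
  proof -
    let ?a = "\<lambda>k :: nat. t powr (- real n) * 2 powr (- (m * real k))"
    let ?D = "\<lambda>k :: nat. ball 0 (t * 2 ^ Suc k) :: (real ^ 'n) set"
    have single: "F k \<le> (\<Sum>k. F k)" for F :: "nat \<Rightarrow> ennreal" and k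
      using sum_le_suminf[of F "{k}"] by simp
    \<comment> \<open>The summand belonging to the shell of \<open>x\<close> already dominates. Full
      balls replace the shells; their overlap only enlarges the sum.\<close>
    have le: "ennreal (norm (eta t m x)) \<le> (\<Sum>k. ennreal (?a k) * indicator (?D k) x)" for x :: "real ^ 'n"
    proof -
      have "1 \<le> 1 + norm x / t"
        using t by simp
      then obtain k where k: "2 ^ k \<le> 1 + norm x / t" "1 + norm x / t < 2 ^ Suc k"
        by (rule dyadic_shell)
      have "(1 + norm x / t) powr (- m) \<le> (2 ^ k) powr (- m)"
        using k(1) m by (intro powr_mono2') auto
      also have "\<dots> = 2 powr (- (m * real k))"
        by (simp add: powr_powr mult.commute flip: powr_realpow)
      finally have "norm (eta t m x) \<le> ?a k"
        using t by (simp add: norm_eta n_def mult_left_mono)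
      moreover have "norm x / t < 2 ^ Suc k"
        using k(2) by linarith
      then have "x \<in> ?D k"
        using t by (simp add: field_simps)
      ultimately have "ennreal (norm (eta t m x)) \<le> ennreal (?a k) * indicator (?D k) x"
        by (simp add: ennreal_leI)
      also have "\<dots> \<le> (\<Sum>k. ennreal (?a k) * indicator (?D k) x)"
        by (rule single)
      finally show ?thesis .
    qed
    have "Lp_norm 1 (eta t m :: real ^ 'n \<Rightarrow> complex)
        \<le> (\<integral>\<^sup>+x. (\<Sum>k. ennreal (?a k) * indicator (?D k) x) \<partial>lebesgue)"
      unfolding Lp_norm_one by (intro nn_integral_mono le)
    also have "\<dots> = (\<Sum>k. \<integral>\<^sup>+x. ennreal (?a k) * indicator (?D k) x \<partial>lebesgue)"
      by (intro nn_integral_suminf borel_measurable_times_ennreal borel_measurable_indicator) auto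
    also have "\<dots> = (\<Sum>k. ennreal (V * 2 ^ n * q ^ k))"
    proof (rule suminf_cong)
      fix k :: nat
      \<comment> \<open>The height and the volume carry opposite powers of \<open>t\<close>, which
        is why the constant is independent of \<open>t\<close>.\<close>
      have t_pow: "t powr (- real n) * t ^ n = 1"
        using t by (simp add: powr_minus powr_realpow field_simps)
      have q_pow: "q ^ k = (2 ^ k) ^ n * 2 powr (- (m * real k))"
      proof -
        have "q ^ k = 2 powr (real n * real k + - (m * real k))"
          using powr_powr[of 2 "real n - m" "real k"] powr_realpow[OF q(1), of k]
          by (simp add: q_def left_diff_distrib)
        moreover have "2 powr (real n * real k) = (2 ^ k :: real) ^ n"
          using powr_realpow[of "2 :: real" "k * n"] by (simp add: power_mult mult.commute)
        ultimately show ?thesis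
          by (simp only: powr_add)
      qed
      have "(\<integral>\<^sup>+x. ennreal (?a k) * indicator (?D k) x \<partial>lebesgue) = ennreal (?a k) * emeasure lborel (?D k)"
        by (subst nn_integral_cmult_indicator) auto
      also have "emeasure lborel (?D k) = ennreal (V * (t * 2 ^ Suc k) ^ n)"
        using t by (subst emeasure_ball) (auto simp: V_def n_def)
      also have "ennreal (?a k) * \<dots> = ennreal (?a k * (V * (t * 2 ^ Suc k) ^ n))"
        using t V by (intro ennreal_mult[symmetric]) auto
      also have "?a k * (V * (t * 2 ^ Suc k) ^ n)
          = (t powr (- real n) * t ^ n) * (V * 2 ^ n * ((2 ^ k) ^ n * 2 powr (- (m * real k))))"
        by (simp only: power_mult_distrib power_Suc ac_simps)
      finally show "(\<integral>\<^sup>+x. ennreal (?a k) * indicator (?D k) x \<partial>lebesgue) = ennreal (V * 2 ^ n * q ^ k)"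
        by (simp only: t_pow q_pow mult_1)
    qed
    also have "\<dots> = ennreal (\<Sum>k. V * 2 ^ n * q ^ k)"
      using q V by (intro suminf_ennreal2 summable_mult summable_geometric) auto
    also have "(\<Sum>k. V * 2 ^ n * q ^ k) = V * 2 ^ n / (1 - q)"
      using q by (simp add: suminf_mult suminf_geometric summable_geometric)
    finally show ?thesis
      by (rule order_trans) (simp add: c_def ennreal_leI)
  qed
  then show thesis
    using that[of c] by (simp add: c_def)
qed

text \<open>Interpolation between the supremum bound \<open>t powr (- n)\<close>, with
  \<open>n\<close> the dimension, and the bound \<open>c\<close> in L^1: all but one of the
  \<open>v\<close> factors of the kernel are estimated by its supremum.\<close>

lemma Lp_norm_eta_le:
  assumes c: "1 \<le> c" "Lp_norm 1 (eta t m :: real ^ 'n \<Rightarrow> complex) \<le> ennreal c"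
    and t: "0 < t" and m: "0 \<le> m" and s: "1 \<le> s"
  shows "Lp_norm s (eta t m :: real ^ 'n \<Rightarrow> complex)
    \<le> ennreal (c * t powr (- real CARD('n) * (1 - enn2real (1 / s))))"
proof (cases s)
  case top
  have "norm (eta t m x) \<le> c * t powr (- real CARD('n))" for x :: "real ^ 'n"
    using norm_eta_le[OF t m, of x] mult_right_mono[OF c(1), of "t powr (- real CARD('n))"] by simp
  then show ?thesis
    using top c by (simp add: Lp_norm_top_le_iff)
next
  case (real v)
  have v: "1 \<le> v"
    using s real by simp
  let ?T = "t powr (- real CARD('n))"
  have "norm (eta t m x) powr v \<le> ?T powr (v - 1) * norm (eta t m x)" for x :: "real ^ 'n"
  proof -
    have "norm (eta t m x) powr (v - 1) * norm (eta t m x) powr 1 \<le> ?T powr (v - 1) * norm (eta t m x) powr 1"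
      using norm_eta_le[OF t m, of x] v by (intro mult_right_mono powr_mono2) auto
    then show ?thesis
      by (simp only: powr_add[symmetric]) simp
  qed
  then have "(\<integral>\<^sup>+x. ennreal (norm (eta t m x) powr v) \<partial>(lebesgue :: (real ^ 'n) measure))
      \<le> (\<integral>\<^sup>+x. ennreal (?T powr (v - 1)) * ennreal (norm (eta t m x)) \<partial>(lebesgue :: (real ^ 'n) measure))"
    by (intro nn_integral_mono) (simp flip: ennreal_mult)
  also have "\<dots> = ennreal (?T powr (v - 1)) * Lp_norm 1 (eta t m :: real ^ 'n \<Rightarrow> complex)"
    unfolding Lp_norm_one by (rule nn_integral_cmult) measurable
  also have "\<dots> \<le> ennreal (?T powr (v - 1)) * ennreal (c powr v)"
    using c powr_mono[of 1 v c] v by (intro mult_left_mono) (auto intro: order_trans ennreal_leI)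
  also have "\<dots> = ennreal ((c * t powr (- real CARD('n) * (1 - 1 / v))) powr v)"
  proof -
    have "- real CARD('n) * (1 - 1 / v) * v = - real CARD('n) * (v - 1)"
      using v by (simp add: field_simps)
    then have "(c * t powr (- real CARD('n) * (1 - 1 / v))) powr v = ?T powr (v - 1) * c powr v"
      by (simp only: powr_mult powr_powr mult.commute)
    then show ?thesis
      by (simp add: ennreal_mult)
  qed
  finally show ?thesis
    using real v s c by (simp add: Lp_norm_le_iff divide_ennreal flip: ennreal_1)
qed

subsection \<open>Cutting at height one\<close>

lemma Lp_norm_large_part_le:
  assumes [measurable]: "f \<in> borel_measurable lebesgue" "p \<in> borel_measurable lebesgue"
    and s: "1 \<le> s" "AE x in lebesgue. s \<le> p x" and mod: "modular p f \<le> 1"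
  shows "Lp_norm s (\<lambda>x. if 1 < norm (f x) then f x else 0) \<le> 1"
proof (cases s)
  case top
  \<comment> \<open>Here \<open>p\<close> is infinite almost everywhere, so a finite modular forces
    \<open>norm (f x) \<le> 1\<close> almost everywhere and the cut-off part vanishes.\<close>
  have "modular p f \<noteq> \<infinity>"
    using mod by (auto simp: top_unique)
  then have "AE x in lebesgue. omega_mod (p x) (norm (f x)) \<noteq> \<infinity>"
    unfolding modular_def by (intro nn_integral_PInf_AE borel_measurable_omega_mod) auto
  then have "AE x in lebesgue. norm (if 1 < norm (f x) then f x else 0) \<le> 1"
    using s(2) by eventually_elim (use top in \<open>auto simp: omega_mod_def top_unique split: if_splits\<close>)
  then show ?thesis
    using top Lp_norm_top_le_iff[of "\<lambda>x. if 1 < norm (f x) then f x else 0" 1] by simp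
next
  case (real v)
  have "(\<integral>\<^sup>+x. ennreal (norm (if 1 < norm (f x) then f x else 0) powr v) \<partial>lebesgue) \<le> modular p f"
    unfolding modular_def
  proof (rule nn_integral_mono_AE)
    show "AE x in lebesgue. ennreal (norm (if 1 < norm (f x) then f x else 0) powr v)
        \<le> omega_mod (p x) (norm (f x))"
      using s(2)
    proof eventually_elim
      case (elim x)
      then show ?case
        using real by (cases "p x") (auto simp: omega_mod_def intro!: ennreal_leI powr_mono)
    qed
  qed
  then show ?thesis
    using mod s(1) real Lp_norm_le_iff[of s 1 "\<lambda>x. if 1 < norm (f x) then f x else 0"] by simp
qed

lemma Lp_norm_small_part_le:
  assumes [measurable]: "f \<in> borel_measurable lebesgue"
    and s: "1 \<le> s" "AE x in lebesgue. p x \<le> s" and mod: "modular p f \<le> 1"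
  shows "Lp_norm s (\<lambda>x. if 1 < norm (f x) then 0 else f x) \<le> 1"
proof (cases s)
  case top
  then show ?thesis
    using Lp_norm_top_le_iff[of "\<lambda>x. if 1 < norm (f x) then 0 else f x" 1] by simp
next
  case (real v)
  have "(\<integral>\<^sup>+x. ennreal (norm (if 1 < norm (f x) then 0 else f x) powr v) \<partial>lebesgue) \<le> modular p f"
    unfolding modular_def
  proof (rule nn_integral_mono_AE)
    show "AE x in lebesgue. ennreal (norm (if 1 < norm (f x) then 0 else f x) powr v)
        \<le> omega_mod (p x) (norm (f x))"
      using s(2)
    proof eventually_elim
      case (elim x)
      then show ?case
        using real by (cases "p x") (auto simp: omega_mod_def top_unique intro!: ennreal_leI powr_mono')
    qed
  qed
  then show ?thesis
    using mod s(1) real Lp_norm_le_iff[of s 1 "\<lambda>x. if 1 < norm (f x) then 0 else f x"] by simp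
qed

text \<open>Below height 1 the power \<open>v\<close> of \<open>norm (f x)\<close> is at most
  \<open>norm (f x)\<close> itself, which is controlled in L^1; above it the modular takes over. The
  two integrals add up to at most 2, hence at most \<open>2 powr v\<close>.\<close>

lemma Lp_norm_le_2:
  assumes [measurable]: "f \<in> borel_measurable lebesgue" "p \<in> borel_measurable lebesgue"
    and s: "1 \<le> s" "AE x in lebesgue. s \<le> p x" and mod: "modular p f \<le> 1" and one: "Lp_norm 1 f \<le> 1"
  shows "Lp_norm s f \<le> ennreal 2"
proof (cases s)
  case top
  have "AE x in lebesgue. norm (if 1 < norm (f x) then f x else 0) \<le> 1"
    using Lp_norm_large_part_le[OF assms(1-5)] top
      Lp_norm_top_le_iff[of "\<lambda>x. if 1 < norm (f x) then f x else 0" 1] by simp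
  then have "AE x in lebesgue. norm (f x) \<le> 2"
    by (rule eventually_mono) (auto split: if_splits)
  then show ?thesis
    using top Lp_norm_top_le_iff[of f 2] by simp
next
  case (real v)
  have v: "1 \<le> v"
    using s(1) real by simp
  have "(\<integral>\<^sup>+x. ennreal (norm (f x) powr v) \<partial>lebesgue)
      \<le> (\<integral>\<^sup>+x. ennreal (norm (if 1 < norm (f x) then f x else 0) powr v) + ennreal (norm (f x)) \<partial>lebesgue)"
    using powr_mono'[OF v] by (intro nn_integral_mono) auto
  also have "\<dots> = (\<integral>\<^sup>+x. ennreal (norm (if 1 < norm (f x) then f x else 0) powr v) \<partial>lebesgue) + Lp_norm 1 f"
    unfolding Lp_norm_one by (rule nn_integral_add) measurable
  also have "\<dots> \<le> 1 + 1"
    using Lp_norm_large_part_le[OF assms(1-5)] real s(1)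
      Lp_norm_le_iff[of s 1 "\<lambda>x. if 1 < norm (f x) then f x else 0"] one
    by (intro add_mono) simp_all
  also have "\<dots> \<le> ennreal (2 powr v)"
    using powr_mono[OF v, of 2] by (simp flip: ennreal_1 ennreal_plus)
  finally show ?thesis
    using real s(1) Lp_norm_le_iff[of s 2 f] by simp
qed

subsection \<open>Convolution estimates\<close>

text \<open>This provides the uniform bound \<open>A\<close> for the interpolation. Hoelder's
  inequality in L^s costs \<open>\<tau> powr (- n / s)\<close>, with \<open>n\<close> the dimension.
  The part above height 1 uses \<open>exp_minus p\<close>; the part below uses the infinite exponent
  if \<open>\<tau> \<le> 1\<close> and \<open>exp_plus p\<close> otherwise. The larger cost is the
  one with \<open>zeta_exp\<close>, and the factor 2 counts the two parts.\<close>

lemma nn_integral_eta_le: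
  fixes f :: "real ^ 'n \<Rightarrow> complex"
  assumes p: "p \<in> var_exponents" and f [measurable]: "f \<in> borel_measurable lebesgue"
    and mod: "modular p f \<le> 1"
    and c: "1 \<le> c" "Lp_norm 1 (eta \<tau> m :: real ^ 'n \<Rightarrow> complex) \<le> ennreal c"
    and \<tau>: "0 < \<tau>" and m: "0 \<le> m"
  shows "(\<integral>\<^sup>+y. ennreal (norm (eta \<tau> m (x - y)) * norm (f y)) \<partial>lebesgue)
    \<le> ennreal (2 * c * \<tau> powr (- real CARD('n) * zeta_exp p \<tau>))"
proof -
  let ?n = "real CARD('n)"
  have p1: "1 \<le> exp_minus p" "1 \<le> exp_plus p"
    using p exp_minus_ge[of 1 p] exp_minus_le_exp_plus[of p] by (auto simp: var_exponents_def)
  have [measurable]: "p \<in> borel_measurable lebesgue"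
    using p by (simp add: var_exponents_def)
  define z where "z = \<tau> powr (- ?n * zeta_exp p \<tau>)"
  have part: "(\<integral>\<^sup>+y. ennreal (norm (eta \<tau> m (x - y)) * norm (h y)) \<partial>lebesgue) \<le> ennreal (c * z)"
    if [measurable]: "h \<in> borel_measurable lebesgue"
      and s: "1 \<le> s" "Lp_norm s h \<le> 1"
      and le: "\<tau> powr (- ?n * enn2real (1 / s)) \<le> z" for h s
  proof -
    obtain t where t: "1 \<le> t" "1 / t + 1 / s = 1"
      using conjugate_exists[OF s(1)] .
    have "(\<integral>\<^sup>+y. ennreal (norm (eta \<tau> m (x - y)) * norm (h y)) \<partial>lebesgue)
        \<le> ennreal (c * \<tau> powr (- ?n * (1 - enn2real (1 / t))) * 1)"
      using Lp_Hoelder_reflect[OF borel_measurable_eta that(1) t _ zero_less_one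
          Lp_norm_eta_le[OF c \<tau> m t(1)], of x] s c \<tau> by simp
    also have "\<dots> \<le> ennreal (c * z)"
      using le c by (intro ennreal_leI) (simp add: enn2real_conjugate[OF t(2)])
    finally show ?thesis .
  qed
  let ?f1 = "\<lambda>y. if 1 < norm (f y) then 0 else f y" and ?f2 = "\<lambda>y. if 1 < norm (f y) then f y else 0"
  have small: "(\<integral>\<^sup>+y. ennreal (norm (eta \<tau> m (x - y)) * norm (?f1 y)) \<partial>lebesgue) \<le> ennreal (c * z)"
  \<comment> \<open>For small \<open>\<tau>\<close> the infinite exponent costs a factor 1, and
    \<open>z\<close> is at least 1; for large \<open>\<tau>\<close> decay is needed, and
    \<open>exp_plus p\<close> yields exactly \<open>z\<close>.\<close>
  proof (cases "\<tau> \<le> 1")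
    case True
    show ?thesis
    proof (rule part[of _ \<infinity>])
      show "Lp_norm \<infinity> ?f1 \<le> 1"
        by (rule Lp_norm_small_part_le[OF f _ _ mod]) auto
      show "\<tau> powr (- ?n * enn2real (1 / \<infinity>)) \<le> z"
        using True \<tau> powr_mono'[of "- ?n * zeta_exp p \<tau>" 0 \<tau>] by (simp add: z_def zeta_exp_def)
    qed auto
  next
    case False
    show ?thesis
    proof (rule part[of _ "exp_plus p"])
      show "Lp_norm (exp_plus p) ?f1 \<le> 1"
        by (rule Lp_norm_small_part_le[OF f p1(2) AE_le_exp_plus mod])
      show "\<tau> powr (- ?n * enn2real (1 / exp_plus p)) \<le> z"
        using False by (simp add: z_def zeta_exp_def)
    qed (use p1 in auto)
  qed
  have large: "(\<integral>\<^sup>+y. ennreal (norm (eta \<tau> m (x - y)) * norm (?f2 y)) \<partial>lebesgue) \<le> ennreal (c * z)"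
  proof (rule part[of _ "exp_minus p"])
    show "Lp_norm (exp_minus p) ?f2 \<le> 1"
      by (rule Lp_norm_large_part_le[OF f _ p1(1) AE_exp_minus_le mod]) measurable
    have "enn2real (1 / exp_plus p) \<le> enn2real (1 / exp_minus p)"
      using p1 exp_minus_le_exp_plus[of p]
      by (cases "exp_minus p"; cases "exp_plus p")
        (auto simp: divide_ennreal frac_le top_unique simp flip: ennreal_1)
    then show "\<tau> powr (- ?n * enn2real (1 / exp_minus p)) \<le> z"
      by (cases "\<tau> \<le> 1") (auto simp: z_def zeta_exp_def intro!: powr_mono)
  qed (use p1 in auto)
  have [measurable]: "(\<lambda>y. eta \<tau> m (x - y)) \<in> borel_measurable lebesgue"
    by (rule borel_measurable_reflect) measurable
  have "(\<integral>\<^sup>+y. ennreal (norm (eta \<tau> m (x - y)) * norm (f y)) \<partial>lebesgue)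
      = (\<integral>\<^sup>+y. ennreal (norm (eta \<tau> m (x - y)) * norm (?f1 y))
        + ennreal (norm (eta \<tau> m (x - y)) * norm (?f2 y)) \<partial>lebesgue)"
    by (intro nn_integral_cong) auto
  also have "\<dots> = (\<integral>\<^sup>+y. ennreal (norm (eta \<tau> m (x - y)) * norm (?f1 y)) \<partial>lebesgue)
      + (\<integral>\<^sup>+y. ennreal (norm (eta \<tau> m (x - y)) * norm (?f2 y)) \<partial>lebesgue)"
    by (rule nn_integral_add) measurable
  also have "\<dots> \<le> ennreal (c * z) + ennreal (c * z)"
    by (intro add_mono small large)
  also have "\<dots> = ennreal (2 * c * z)"
    using c by (simp add: z_def flip: ennreal_plus)
  finally show ?thesis
    by (simp add: z_def)
qed

section \<open>Homogeneity: from normalised functions to norm inequalities\<close>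

lemma Lp_norm_scale_le:
  assumes [measurable]: "f \<in> borel_measurable lebesgue"
    and s: "1 \<le> s" and l: "0 < l" and le: "Lp_norm s f \<le> ennreal l"
  shows "Lp_norm s (\<lambda>x. f x / complex_of_real l) \<le> 1"
proof (cases s)
  case top
  have "AE x in lebesgue. norm (f x) \<le> l"
    using le top l by (simp add: Lp_norm_top_le_iff)
  then have "AE x in lebesgue. norm (f x / complex_of_real l) \<le> 1"
    by (rule eventually_mono) (use l in \<open>auto simp: norm_divide\<close>)
  then show ?thesis
    using top Lp_norm_top_le_iff[of "\<lambda>x. f x / complex_of_real l" 1] by simp
next
  case (real v)
  have "(\<integral>\<^sup>+x. ennreal (norm (f x / complex_of_real l) powr v) \<partial>lebesgue)
      = (\<integral>\<^sup>+x. ennreal (1 / l powr v) * ennreal (norm (f x) powr v) \<partial>lebesgue)"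
    using l by (intro nn_integral_cong) (simp add: norm_divide powr_divide flip: ennreal_mult)
  also have "\<dots> = ennreal (1 / l powr v) * (\<integral>\<^sup>+x. ennreal (norm (f x) powr v) \<partial>lebesgue)"
    by (rule nn_integral_cmult) measurable
  also have "\<dots> \<le> ennreal (1 / l powr v) * ennreal (l powr v)"
    using le Lp_norm_le_iff[of s l f] s real l by (intro mult_left_mono) auto
  also have "\<dots> = 1"
    using l by (simp flip: ennreal_mult)
  finally show ?thesis
    using real s Lp_norm_le_iff[of s 1 "\<lambda>x. f x / complex_of_real l"] by simp
qed

text \<open>Normalisation divides by a positive real strictly above the norm, which also covers norm
  0; this is the passage to the limit afterwards.\<close>

lemma ennreal_le_cmult_of_less:
  fixes x K :: ennreal
  assumes "0 \<le> D" "K < \<infinity>" and le: "\<And>l. 0 < l \<Longrightarrow> K < ennreal l \<Longrightarrow> x \<le> ennreal (D * l)"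
  shows "x \<le> ennreal D * K"
proof (rule ennreal_le_epsilon)
  fix e :: real assume e: "0 < e"
  obtain k where k: "K = ennreal k" "0 \<le> k"
    using assms(2) by (cases K) auto
  \<comment> \<open>The summand 1 keeps the denominator positive when \<open>D = 0\<close>.\<close>
  define d where "d = e / (D + 1)"
  have d: "0 < d" "D * d \<le> e"
    using e assms(1) by (auto simp: d_def field_simps)
  have "x \<le> ennreal (D * (k + d))"
    using k d by (intro le) (auto simp: ennreal_less_iff)
  also have "\<dots> \<le> ennreal (D * k + e)"
    using d by (intro ennreal_leI) (simp add: distrib_left)
  also have "\<dots> = ennreal D * K + ennreal e"
    using k e assms(1) by (simp add: ennreal_mult)
  finally show "x \<le> ennreal D * K + ennreal e" .
qed

text \<open>Reduction to normalised \<open>f\<close>: dividing by any \<open>l\<close> above both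
  norms gives an admissible function, and the convolution is linear in \<open>f\<close>. A single
  \<open>l\<close> suffices for existence and membership, whereas the norm bound lets
  \<open>l\<close> decrease to the larger norm.\<close>

lemma Lvar_norm_conv_le:
  fixes r p :: "real ^ 'n \<Rightarrow> ennreal"
  assumes p: "p \<in> var_exponents" and k: "k \<in> borel_measurable lebesgue"
    and \<nu>: "1 \<le> \<nu>" and D: "0 < D"
    and unit: "\<And>f. f \<in> borel_measurable lebesgue \<Longrightarrow> modular p f \<le> 1 \<Longrightarrow> Lp_norm \<nu> f \<le> 1 \<Longrightarrow>
      (\<forall>x. integrable lebesgue (\<lambda>y. k (x - y) * f y)) \<and>
      modular r (\<lambda>x. conv k f x / complex_of_real D) \<le> 1"
    and f: "f \<in> Lvar p \<inter> Lp \<nu>"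
  shows "conv_defined k f \<and> conv k f \<in> Lvar r \<and>
    Lvar_norm r (conv k f) \<le> ennreal D * max (Lvar_norm p f) (Lp_norm \<nu> f)"
proof -
  define F where "F = max (Lvar_norm p f) (Lp_norm \<nu> f)"
  have F: "F < \<infinity>"
    using Lvar_norm_finite[OF p, of f] f by (auto simp: F_def Lp_def)
  have fm [measurable]: "f \<in> borel_measurable lebesgue"
    using f by (auto simp: Lvar_def)
  have scaled: "(\<forall>x. integrable lebesgue (\<lambda>y. k (x - y) * f y)) \<and>
      modular r (\<lambda>x. conv k f x / complex_of_real (D * l)) \<le> 1"
    if l: "0 < l" "F < ennreal l" for l
  proof -
    let ?g = "\<lambda>x. f x / complex_of_real l"
    have *: "(\<forall>x. integrable lebesgue (\<lambda>y. k (x - y) * ?g y)) \<and>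
        modular r (\<lambda>x. conv k ?g x / complex_of_real D) \<le> 1"
    proof (rule unit)
      show "modular p ?g \<le> 1"
        using l by (intro modular_le_one) (simp add: F_def)
      show "Lp_norm \<nu> ?g \<le> 1"
        using l by (intro Lp_norm_scale_le \<nu> fm) (auto simp: F_def less_imp_le)
    qed measurable
    have "integrable lebesgue (\<lambda>y. k (x - y) * f y)" for x
    proof -
      have "integrable lebesgue (\<lambda>y. (k (x - y) * ?g y) * complex_of_real l)"
        using * by (intro integrable_mult_left) blast
      then show ?thesis
        using l by simp
    qed
    moreover have "conv k ?g x / complex_of_real D = conv k f x / complex_of_real (D * l)" for x
      by (simp add: conv_def mult.commute)
    ultimately show ?thesis
      using * by simp
  qed
  obtain l0 where l0: "0 < l0" "F < ennreal l0"
  proof -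
    obtain u where "F = ennreal u" "0 \<le> u"
      using F by (cases F) auto
    then show thesis
      using that[of "u + 1"] by (simp add: ennreal_less_iff)
  qed
  have "conv_defined k f"
    using scaled[OF l0] by (simp add: conv_defined_def)
  moreover have "conv k f \<in> Lvar r"
  proof -
    have "modular r (\<lambda>x. complex_of_real (1 / (D * l0)) * conv k f x) < \<infinity>"
      using scaled[OF l0] by (auto intro: le_less_trans)
    then show ?thesis
      using borel_measurable_conv[OF k fm] l0 D
      unfolding Lvar_def by (intro CollectI conjI exI[of _ "1 / (D * l0)"]) auto
  qed
  moreover have "Lvar_norm r (conv k f) \<le> ennreal D * F"
    using D scaled by (intro ennreal_le_cmult_of_less F Lvar_norm_le) auto
  ultimately show ?thesis
    by (simp add: F_def)
qed

lemma exp_minus_ge_one: "p \<in> var_exponents \<Longrightarrow> 1 \<le> exp_minus p"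
  by (rule exp_minus_ge) (simp add: var_exponents_def)

text \<open>Common core of the first and the fourth assertion. The kernel is bounded by one number
  \<open>l\<close> in both norms, so the uniform bound and the bound in L^(r^-) can be taken equal
  and the interpolation becomes trivial.\<close>

lemma Lvar_norm_conv_le_max:
  fixes r p :: "real ^ 'n \<Rightarrow> ennreal"
  assumes r: "r \<in> var_exponents" and p: "p \<in> var_exponents"
    and st: "1 \<le> s" "1 / s + 1 / t = 1" and C: "1 \<le> C"
    and emb: "\<And>f. f \<in> borel_measurable lebesgue \<Longrightarrow> modular p f \<le> 1 \<Longrightarrow> Lp_norm 1 f \<le> 1 \<Longrightarrow>
      Lp_norm t f \<le> ennreal C"
    and k: "k \<in> Lp s \<inter> Lp (exp_minus r)" and f: "f \<in> Lvar p \<inter> Lp 1"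
  shows "conv_defined k f \<and> conv k f \<in> Lvar r \<and>
    Lvar_norm r (conv k f) \<le> ennreal C * max (Lp_norm s k) (Lp_norm (exp_minus r) k)
      * max (Lvar_norm p f) (Lp_norm 1 f)"
proof -
  define K where "K = max (Lp_norm s k) (Lp_norm (exp_minus r) k)"
  define F where "F = max (Lvar_norm p f) (Lp_norm 1 f)"
  have km: "k \<in> borel_measurable lebesgue"
    using k by (simp add: Lp_def)
  have K: "K < \<infinity>"
    using k by (simp add: K_def Lp_def)
  have "F < \<infinity>"
    using Lvar_norm_finite[OF p, of f] f by (auto simp: F_def Lp_def)
  then obtain \<phi> where \<phi>: "F = ennreal \<phi>" "0 \<le> \<phi>"
    by (cases F) auto
  have main: "conv_defined k f \<and> conv k f \<in> Lvar r \<and> Lvar_norm r (conv k f) \<le> ennreal (C * l) * F"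
    if l: "0 < l" "K < ennreal l" for l
    unfolding F_def
  proof (rule Lvar_norm_conv_le[OF p km order_refl _ _ f])
    show "0 < C * l"
      using C l by simp
    fix g :: "real ^ 'n \<Rightarrow> complex"
    assume g: "g \<in> borel_measurable lebesgue" "modular p g \<le> 1" "Lp_norm 1 g \<le> 1"
    have kl: "Lp_norm s k \<le> ennreal l" "Lp_norm (exp_minus r) k \<le> ennreal l"
      using l by (auto simp: K_def)
    have sup: "(\<integral>\<^sup>+y. ennreal (norm (k (x - y)) * norm (g y)) \<partial>lebesgue) \<le> ennreal (C * l)" for x
      using Lp_Hoelder_reflect[OF km g(1) st l(1) _ kl(1) emb[OF g]] C by (simp add: mult.commute)
    have "Lp_norm (exp_minus r) (conv k g) \<le> ennreal (l * 1)"
      using g by (intro Lp_norm_conv_le km l kl exp_minus_ge_one r) auto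
    also have "\<dots> \<le> ennreal (C * l)"
      using C l by (intro ennreal_leI) simp
    \<comment> \<open>With \<open>A = B = C * l\<close> the two powers multiply to
      \<open>C * l\<close> whatever the quotient is, even for infinite \<open>exp_minus r\<close>,
      where it is 0.\<close>
    finally have "modular r (\<lambda>x. conv k g x / complex_of_real
        ((C * l) powr (1 - enn2real (exp_minus r / exp_minus r)) * (C * l) powr enn2real (exp_minus r / exp_minus r))) \<le> 1"
      using C l AE_exp_minus_le[of r] norm_conv_le(2)[OF km g(1) sup]
      by (intro modular_interpolation exp_minus_ge_one r borel_measurable_conv km g) auto
    then have "modular r (\<lambda>x. conv k g x / complex_of_real (C * l)) \<le> 1"
      using C l by (simp flip: powr_add)
    then show "(\<forall>x. integrable lebesgue (\<lambda>y. k (x - y) * g y)) \<and>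
        modular r (\<lambda>x. conv k g x / complex_of_real (C * l)) \<le> 1"
      using norm_conv_le(1)[OF km g(1) sup] C l by simp
  qed
  obtain l0 where "0 < l0" "K < ennreal l0"
  proof -
    obtain u where "K = ennreal u" "0 \<le> u"
      using K by (cases K) auto
    then show thesis
      using that[of "u + 1"] by (simp add: ennreal_less_iff)
  qed
  \<comment> \<open>The bound is linear in \<open>l\<close>, so \<open>l\<close> may now decrease to
    \<open>K\<close>.\<close>
  moreover have "Lvar_norm r (conv k f) \<le> ennreal (C * \<phi>) * K"
  proof (rule ennreal_le_cmult_of_less)
    show "Lvar_norm r (conv k f) \<le> ennreal (C * \<phi> * l)" if "0 < l" "K < ennreal l" for l
      using main[OF that] \<phi> C that by (simp add: ac_simps flip: ennreal_mult)
  qed (use C \<phi> K in auto)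
  then have "Lvar_norm r (conv k f) \<le> ennreal C * K * F"
    using \<phi> C by (simp add: ennreal_mult ac_simps)
  ultimately show ?thesis
    using main unfolding K_def F_def by blast
qed

text \<open>Common core of the second and the third assertion. The number \<open>b\<close> is the
  decay exponent of the bound in L^\<nu>: it is \<open>1 - 1 / r^-\<close> for
  \<open>\<mu> = 1\<close> and \<open>\<nu> = r^-\<close>, and 0 for \<open>\<mu> = \<nu>\<close>.
  Interpolation averages \<open>zeta_exp p \<tau>\<close> and \<open>b\<close> with weights
  \<open>1 - \<beta>\<close> and \<open>\<beta>\<close>.\<close>

lemma Lvar_norm_conv_eta_le:
  fixes r p :: "real ^ 'n \<Rightarrow> ennreal" and \<mu> \<nu> \<rho> :: ennreal and b :: real
  defines "\<beta> \<equiv> enn2real (\<nu> / \<rho>)"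
  assumes r: "r \<in> var_exponents" and p: "p \<in> var_exponents" and m: "0 \<le> m"
    and c: "1 \<le> c" "Lp_norm 1 (eta \<tau> m :: real ^ 'n \<Rightarrow> complex) \<le> ennreal c"
    and \<tau>: "0 < \<tau>" and \<mu>: "1 \<le> \<mu>" and \<nu>: "1 \<le> \<nu>" "\<nu> \<le> exp_minus r"
    and conv: "\<And>f :: real ^ 'n \<Rightarrow> complex. f \<in> borel_measurable lebesgue \<Longrightarrow> Lp_norm \<mu> f \<le> 1 \<Longrightarrow>
      Lp_norm \<nu> (conv (eta \<tau> m) f) \<le> ennreal (c * \<tau> powr (- real CARD('n) * b))"
    and \<rho>: "\<tau> powr (- real CARD('n) * zeta_exp p \<tau>) \<le> \<tau> powr (- real CARD('n) * b) \<and> \<rho> = exp_minus r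
      \<or> \<tau> powr (- real CARD('n) * b) \<le> \<tau> powr (- real CARD('n) * zeta_exp p \<tau>) \<and> \<rho> = exp_plus r"
    and f: "f \<in> Lvar p \<inter> Lp \<mu>"
  shows "conv_defined (eta \<tau> m) f \<and> conv (eta \<tau> m) f \<in> Lvar r \<and>
    Lvar_norm r (conv (eta \<tau> m) f)
      \<le> ennreal (2 * c * \<tau> powr (- real CARD('n) * (zeta_exp p \<tau> * (1 - \<beta>) + b * \<beta>)))
        * max (Lvar_norm p f) (Lp_norm \<mu> f)"
proof (rule Lvar_norm_conv_le[OF p borel_measurable_eta \<mu> _ _ f])
  let ?n = "real CARD('n)"
  \<comment> \<open>\<open>B\<close> receives the factor 2 as well, so that \<open>A\<close> and
    \<open>B\<close> compare like their powers of \<open>\<tau>\<close> and the constant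
    \<open>2 * c\<close> survives interpolation unchanged.\<close>
  define A B D where "A = 2 * c * \<tau> powr (- ?n * zeta_exp p \<tau>)" and "B = 2 * c * \<tau> powr (- ?n * b)"
    and "D = 2 * c * \<tau> powr (- ?n * (zeta_exp p \<tau> * (1 - \<beta>) + b * \<beta>))"
  have pos: "0 < A" "0 < B" "0 < D"
    using c \<tau> by (auto simp: A_def B_def D_def)
  then show "0 < 2 * c * \<tau> powr (- ?n * (zeta_exp p \<tau> * (1 - \<beta>) + b * \<beta>))"
    by (simp add: D_def)
  have AB: "A powr (1 - \<beta>) * B powr \<beta> = D"
  proof -
    have "A powr (1 - \<beta>) * B powr \<beta> = ((2 * c) powr (1 - \<beta>) * (2 * c) powr \<beta>) *
        (\<tau> powr (- ?n * zeta_exp p \<tau> * (1 - \<beta>)) * \<tau> powr (- ?n * b * \<beta>))"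
      by (simp only: A_def B_def powr_mult powr_powr ac_simps)
    also have "\<dots> = D"
      using c unfolding D_def powr_add[symmetric] by (simp add: algebra_simps)
    finally show ?thesis .
  qed
  fix g :: "real ^ 'n \<Rightarrow> complex"
  assume g: "g \<in> borel_measurable lebesgue" "modular p g \<le> 1" "Lp_norm \<mu> g \<le> 1"
  have sup: "(\<integral>\<^sup>+y. ennreal (norm (eta \<tau> m (x - y)) * norm (g y)) \<partial>lebesgue) \<le> ennreal A" for x
    unfolding A_def by (rule nn_integral_eta_le[OF p g(1,2) c \<tau> m])
  have "Lp_norm \<nu> (conv (eta \<tau> m) g) \<le> ennreal (c * \<tau> powr (- ?n * b))"
    by (rule conv[OF g(1,3)])
  also have "\<dots> \<le> ennreal B"
    using c by (intro ennreal_leI) (simp add: B_def)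
  finally have "modular r (\<lambda>x. conv (eta \<tau> m) g x / complex_of_real (A powr (1 - \<beta>) * B powr \<beta>)) \<le> 1"
    unfolding \<beta>_def
  proof (intro modular_interpolation)
    show "\<nu> \<le> \<rho>"
      using \<rho> \<nu>(2) exp_minus_le_exp_plus[of r] by (auto intro: order_trans)
    show "AE x in lebesgue. \<nu> \<le> r x"
      using AE_exp_minus_le[of r] by eventually_elim (use \<nu>(2) in \<open>auto intro: order_trans\<close>)
    show "AE x in lebesgue. norm (conv (eta \<tau> m) g x) \<le> A"
      using norm_conv_le(2)[OF borel_measurable_eta g(1) sup] pos by auto
    show "A \<le> B \<and> (AE x in lebesgue. \<rho> \<le> r x) \<or> B \<le> A \<and> (AE x in lebesgue. r x \<le> \<rho>)"
      using \<rho>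
    proof (elim disjE conjE)
      assume "\<tau> powr (- ?n * zeta_exp p \<tau>) \<le> \<tau> powr (- ?n * b)" "\<rho> = exp_minus r"
      then show ?thesis
        using AE_exp_minus_le[of r] c by (intro disjI1 conjI) (simp_all add: A_def B_def)
    next
      assume "\<tau> powr (- ?n * b) \<le> \<tau> powr (- ?n * zeta_exp p \<tau>)" "\<rho> = exp_plus r"
      then show ?thesis
        using AE_le_exp_plus[of r] c by (intro disjI2 conjI) (simp_all add: A_def B_def)
    qed
  qed (use pos \<nu> borel_measurable_conv[OF borel_measurable_eta g(1)] in auto)
  then show "(\<forall>x. integrable lebesgue (\<lambda>y. eta \<tau> m (x - y) * g y)) \<and>
      modular r (\<lambda>x. conv (eta \<tau> m) g x /
        complex_of_real (2 * c * \<tau> powr (- ?n * (zeta_exp p \<tau> * (1 - \<beta>) + b * \<beta>)))) \<le> 1"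
    using norm_conv_le(1)[OF borel_measurable_eta g(1) sup] pos unfolding AB by (simp add: D_def)
qed

lemma conjugate_antimono:
  fixes s t s' t' :: ennreal
  assumes st: "1 / s + 1 / t = 1" and st': "1 / s' + 1 / t' = 1" and le: "s \<le> s'"
  shows "t' \<le> t"
  using st
proof (cases rule: conjugate_ennreal_cases)
  case 2
  from st' show ?thesis
    by (cases rule: conjugate_ennreal_cases) (use 2 le in \<open>auto simp: top_unique\<close>)
next
  case (3 a b)
  note ab = this
  from st' show ?thesis
  proof (cases rule: conjugate_ennreal_cases)
    case (3 a' b')
    then have "1 / a' \<le> 1 / a"
      using ab le by (simp add: frac_le)
    then have "1 / b \<le> 1 / b'"
      using ab(5) 3(5) by linarith
    then show ?thesis
      using ab 3 by (simp add: field_simps)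
  qed (use ab le in \<open>auto simp flip: ennreal_1\<close>)
qed simp

theorem theorem3p10:
  fixes r p q :: "real ^ 'n \<Rightarrow> ennreal" and m :: real
  assumes "r \<in> var_exponents" and "p \<in> var_exponents"
    and "conjugate_exponent p q"
    and "m > real CARD('n)"
  shows
    "(\<exists>C>0. \<forall>k \<in> Lp \<infinity> \<inter> Lp (exp_minus r). \<forall>f \<in> Lvar p \<inter> Lp 1.
        conv_defined k f \<and> conv k f \<in> Lvar r \<and>
        Lvar_norm r (conv k f)
          \<le> ennreal C * max (Lp_norm \<infinity> k) (Lp_norm (exp_minus r) k)
              * max (Lvar_norm p f) (Lp_norm 1 f))
   \<and> (\<exists>C>0. \<forall>\<tau>>0. \<forall>f \<in> Lvar p \<inter> Lp 1.
        conv_defined (eta \<tau> m) f \<and> conv (eta \<tau> m) f \<in> Lvar r \<and>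
        Lvar_norm r (conv (eta \<tau> m) f)
          \<le> ennreal (C * \<tau> powr (- real CARD('n) * theta_exp p r \<tau>))
              * max (Lvar_norm p f) (Lp_norm 1 f))
   \<and> (\<forall>\<nu>. 1 \<le> \<nu> \<and> \<nu> \<le> exp_minus r \<longrightarrow>
       (\<exists>C>0. \<forall>\<tau>>0. \<forall>f \<in> Lvar p \<inter> Lp \<nu>.
        conv_defined (eta \<tau> m) f \<and> conv (eta \<tau> m) f \<in> Lvar r \<and>
        Lvar_norm r (conv (eta \<tau> m) f)
          \<le> ennreal (C * \<tau> powr (- real CARD('n) * omega_exp p r \<nu> \<tau>))
              * max (Lvar_norm p f) (Lp_norm \<nu> f)))
   \<and> ((\<lambda>x. 1) \<in> Lvar (gap_exponent p) \<longrightarrow>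
       (\<exists>C>0. \<forall>k \<in> Lp (exp_plus q) \<inter> Lp (exp_minus r). \<forall>f \<in> Lvar p \<inter> Lp 1.
        conv_defined k f \<and> conv k f \<in> Lvar r \<and>
        Lvar_norm r (conv k f)
          \<le> ennreal C * max (Lp_norm (exp_plus q) k) (Lp_norm (exp_minus r) k)
              * max (Lvar_norm p f) (Lp_norm 1 f)))"
proof -
  note r = assms(1) and p = assms(2)
  let ?n = "real CARD('n)"
  obtain c where c: "1 \<le> c"
    "\<And>\<tau>. 0 < \<tau> \<Longrightarrow> Lp_norm 1 (eta \<tau> m :: real ^ 'n \<Rightarrow> complex) \<le> ennreal c"
    using Lp_norm_one_eta[OF assms(4)] by blast
  have m: "0 \<le> m"
    using assms(4) by (meson less_imp_le of_nat_0_le_iff order_trans)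
  have pm: "p \<in> borel_measurable lebesgue"
    using p by (simp add: var_exponents_def)
  show ?thesis
  proof (intro conjI allI impI)
    \<comment> \<open>Hoelder's inequality pairs the bounded kernel with \<open>f\<close> in L^1,
      whose norm is already at hand; hence \<open>C = 1\<close>.\<close>
    show "\<exists>C>0. \<forall>k \<in> Lp \<infinity> \<inter> Lp (exp_minus r). \<forall>f \<in> Lvar p \<inter> Lp 1.
        conv_defined k f \<and> conv k f \<in> Lvar r \<and>
        Lvar_norm r (conv k f)
          \<le> ennreal C * max (Lp_norm \<infinity> k) (Lp_norm (exp_minus r) k)
              * max (Lvar_norm p f) (Lp_norm 1 f)"
      by (intro exI[of _ 1] conjI ballI Lvar_norm_conv_le_max[OF r p, where t = 1]) auto
  next
    show "\<exists>C>0. \<forall>\<tau>>0. \<forall>f \<in> Lvar p \<inter> Lp 1.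
        conv_defined (eta \<tau> m) f \<and> conv (eta \<tau> m) f \<in> Lvar r \<and>
        Lvar_norm r (conv (eta \<tau> m) f)
          \<le> ennreal (C * \<tau> powr (- ?n * theta_exp p r \<tau>))
              * max (Lvar_norm p f) (Lp_norm 1 f)"
    proof (intro exI[of _ "2 * c"] conjI allI impI ballI)
      fix \<tau> :: real and f assume \<tau>: "0 < \<tau>" and f: "f \<in> Lvar p \<inter> Lp 1"
      define \<zeta> a where "\<zeta> = zeta_exp p \<tau>" and "a = 1 - enn2real (1 / exp_minus r)"
      \<comment> \<open>\<open>up\<close> says that the bound in L^(r^-) is at most the uniform one,
        for which \<open>\<rho>\<close> must be \<open>exp_plus r\<close>; the direction flips at
        \<open>\<tau> = 1\<close>. Otherwise \<open>\<rho> = exp_minus r\<close>, and for finite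
        \<open>exp_minus r\<close> this means \<open>\<beta> = 1\<close> and exponent
        \<open>a\<close>.\<close>
      define up where "up \<longleftrightarrow> (\<tau> \<le> 1 \<and> a \<le> \<zeta>) \<or> (\<tau> > 1 \<and> a > \<zeta>)"
      define \<rho> where "\<rho> = (if up then exp_plus r else exp_minus r)"
      define \<beta> where "\<beta> = enn2real (exp_minus r / \<rho>)"
      have r1: "1 \<le> exp_minus r"
        by (rule exp_minus_ge_one[OF r])
      have "conv_defined (eta \<tau> m) f \<and> conv (eta \<tau> m) f \<in> Lvar r \<and>
        Lvar_norm r (conv (eta \<tau> m) f)
          \<le> ennreal (2 * c * \<tau> powr (- ?n * (zeta_exp p \<tau> * (1 - \<beta>) + a * \<beta>)))
              * max (Lvar_norm p f) (Lp_norm 1 f)"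
        unfolding \<beta>_def
      proof (rule Lvar_norm_conv_eta_le[OF r p m c(1) c(2)[OF \<tau>] \<tau> order_refl r1 order_refl _ _ f])
        fix g :: "real ^ 'n \<Rightarrow> complex"
        assume g: "g \<in> borel_measurable lebesgue" "Lp_norm 1 g \<le> 1"
        show "Lp_norm (exp_minus r) (conv (eta \<tau> m) g) \<le> ennreal (c * \<tau> powr (- ?n * a))"
          using Lp_norm_conv_le[OF borel_measurable_eta g(1) r1 _ zero_less_one
              Lp_norm_eta_le[OF c(1) c(2)[OF \<tau>] \<tau> m r1]] g c \<tau>
          by (simp add: a_def)
      next
        show "\<tau> powr (- ?n * zeta_exp p \<tau>) \<le> \<tau> powr (- ?n * a) \<and> \<rho> = exp_minus r \<or>
            \<tau> powr (- ?n * a) \<le> \<tau> powr (- ?n * zeta_exp p \<tau>) \<and> \<rho> = exp_plus r"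
        proof (cases up)
          case True
          then have "\<tau> powr (- ?n * a) \<le> \<tau> powr (- ?n * zeta_exp p \<tau>)"
            using \<tau> powr_mono'[of "- ?n * zeta_exp p \<tau>" "- ?n * a" \<tau>]
              powr_mono[of "- ?n * a" "- ?n * zeta_exp p \<tau>" \<tau>]
            by (cases "\<tau> \<le> 1") (auto simp: up_def \<zeta>_def)
          then show ?thesis
            using True by (simp add: \<rho>_def)
        next
          case False
          then have "\<tau> powr (- ?n * zeta_exp p \<tau>) \<le> \<tau> powr (- ?n * a)"
            using \<tau> powr_mono'[of "- ?n * a" "- ?n * zeta_exp p \<tau>" \<tau>]
              powr_mono[of "- ?n * zeta_exp p \<tau>" "- ?n * a" \<tau>]
            by (cases "\<tau> \<le> 1") (auto simp: up_def \<zeta>_def)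
          then show ?thesis
            using False by (simp add: \<rho>_def)
        qed
      qed
      moreover have "zeta_exp p \<tau> * (1 - \<beta>) + a * \<beta> = theta_exp p r \<tau>"
      proof (cases "exp_minus r = \<infinity>")
        \<comment> \<open>The quotient of two infinite values is 0, so \<open>\<beta>\<close>
          vanishes and only \<open>\<zeta>\<close> remains.\<close>
        case True
        then have "\<rho> = \<infinity>"
          using exp_minus_le_exp_plus[of r] by (auto simp: \<rho>_def top_unique)
        then show ?thesis
          using True by (simp add: \<beta>_def theta_exp_def)
      next
        case False
        then have "exp_minus r / exp_minus r = 1"
          using r1 by (intro ennreal_divide_self) (auto simp: less_top)
        then show ?thesis
          using False \<tau> by (auto simp: \<beta>_def theta_exp_def Let_def \<rho>_def up_def a_def \<zeta>_def)
      qed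
      ultimately show "conv_defined (eta \<tau> m) f" "conv (eta \<tau> m) f \<in> Lvar r"
        "Lvar_norm r (conv (eta \<tau> m) f)
          \<le> ennreal (2 * c * \<tau> powr (- ?n * theta_exp p r \<tau>)) * max (Lvar_norm p f) (Lp_norm 1 f)"
        by auto
    qed (use c in simp)
  next
    fix \<nu> assume \<nu>: "1 \<le> \<nu> \<and> \<nu> \<le> exp_minus r"
    show "\<exists>C>0. \<forall>\<tau>>0. \<forall>f \<in> Lvar p \<inter> Lp \<nu>.
        conv_defined (eta \<tau> m) f \<and> conv (eta \<tau> m) f \<in> Lvar r \<and>
        Lvar_norm r (conv (eta \<tau> m) f)
          \<le> ennreal (C * \<tau> powr (- ?n * omega_exp p r \<nu> \<tau>))
              * max (Lvar_norm p f) (Lp_norm \<nu> f)"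
    proof (intro exI[of _ "2 * c"] conjI allI impI ballI)
      fix \<tau> :: real and f assume \<tau>: "0 < \<tau>" and f: "f \<in> Lvar p \<inter> Lp \<nu>"
      \<comment> \<open>With \<open>b = 0\<close> the bound in L^\<nu> does not depend on
        \<open>\<tau>\<close>. The uniform bound is the larger one for \<open>\<tau> \<le> 1\<close>
        and the smaller one for \<open>\<tau> > 1\<close>.\<close>
      define \<rho> where "\<rho> = (if \<tau> \<le> 1 then exp_plus r else exp_minus r)"
      have "conv_defined (eta \<tau> m) f \<and> conv (eta \<tau> m) f \<in> Lvar r \<and>
        Lvar_norm r (conv (eta \<tau> m) f)
          \<le> ennreal (2 * c * \<tau> powr (- ?n * (zeta_exp p \<tau> * (1 - enn2real (\<nu> / \<rho>)) + 0 * enn2real (\<nu> / \<rho>))))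
              * max (Lvar_norm p f) (Lp_norm \<nu> f)"
      proof (rule Lvar_norm_conv_eta_le[OF r p m c(1) c(2)[OF \<tau>] \<tau> _ _ _ _ _ f])
        fix g :: "real ^ 'n \<Rightarrow> complex"
        assume g: "g \<in> borel_measurable lebesgue" "Lp_norm \<nu> g \<le> 1"
        show "Lp_norm \<nu> (conv (eta \<tau> m) g) \<le> ennreal (c * \<tau> powr (- ?n * 0))"
          \<comment> \<open>The roles are exchanged: \<open>g\<close> is the factor in L^\<nu>, and
            \<open>eta\<close> is the integrable one with norm at most \<open>c\<close>.\<close>
          using Lp_norm_conv_le[OF g(1) borel_measurable_eta, of \<nu> 1 c] g c \<tau> \<nu>
          by (simp add: conv_commute[OF borel_measurable_eta g(1)])
      next
        show "\<tau> powr (- ?n * zeta_exp p \<tau>) \<le> \<tau> powr (- ?n * 0) \<and> \<rho> = exp_minus r \<or>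
            \<tau> powr (- ?n * 0) \<le> \<tau> powr (- ?n * zeta_exp p \<tau>) \<and> \<rho> = exp_plus r"
          using \<tau> powr_mono[of "- ?n * zeta_exp p \<tau>" 0 \<tau>] powr_mono'[of "- ?n * zeta_exp p \<tau>" 0 \<tau>]
          by (auto simp: \<rho>_def zeta_exp_def)
      qed (use \<nu> in auto)
      moreover have "zeta_exp p \<tau> * (1 - enn2real (\<nu> / \<rho>)) = omega_exp p r \<nu> \<tau>"
        by (simp add: \<rho>_def zeta_exp_def omega_exp_def)
      ultimately show "conv_defined (eta \<tau> m) f" "conv (eta \<tau> m) f \<in> Lvar r"
        "Lvar_norm r (conv (eta \<tau> m) f)
          \<le> ennreal (2 * c * \<tau> powr (- ?n * omega_exp p r \<nu> \<tau>)) * max (Lvar_norm p f) (Lp_norm \<nu> f)"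
        by auto
    qed (use c in simp)
  next
    have q: "1 / q x + 1 / p x = 1" for x
      using assms(3) by (simp add: conjugate_exponent_def add.commute)
    have "AE x in (lebesgue :: (real ^ 'n) measure). 1 \<le> exp_plus q"
      using AE_le_exp_plus[of q]
    proof eventually_elim
      case (elim x)
      have "1 \<le> q x"
        using q[of x] by (cases rule: conjugate_ennreal_cases) (auto simp flip: ennreal_1)
      then show ?case
        using elim by (rule order_trans)
    qed
    then have q1: "1 \<le> exp_plus q"
      by (rule AE_lebesgue_const)
    \<comment> \<open>Conjugation reverses order, so \<open>q \<le> exp_plus q\<close> makes
      \<open>t\<close> an essential lower bound of \<open>p\<close>. The embedding
      \<open>Lp_norm_le_2\<close> then applies with \<open>t\<close>, which is where
      \<open>C = 2\<close> comes from.\<close>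
    obtain t where t: "1 \<le> t" "1 / exp_plus q + 1 / t = 1"
      using conjugate_exists[OF q1] by (metis add.commute)
    have tp: "AE x in lebesgue. t \<le> p x"
      using AE_le_exp_plus[of q] by eventually_elim (rule conjugate_antimono[OF q t(2)])
    show "\<exists>C>0. \<forall>k \<in> Lp (exp_plus q) \<inter> Lp (exp_minus r). \<forall>f \<in> Lvar p \<inter> Lp 1.
        conv_defined k f \<and> conv k f \<in> Lvar r \<and>
        Lvar_norm r (conv k f)
          \<le> ennreal C * max (Lp_norm (exp_plus q) k) (Lp_norm (exp_minus r) k)
              * max (Lvar_norm p f) (Lp_norm 1 f)"
      using Lvar_norm_conv_le_max[OF r p q1 t(2), of 2] Lp_norm_le_2[OF _ pm t(1) tp]
      by (intro exI[of _ 2]) (simp del: ennreal_numeral)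
  qed
qed

end
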